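(* Let $(E,H,\mu)$ be an abstract Wiener space, let $x\in E\setminus H$, and let $q_x:E\to[0,\infty]$ and $E_x=\{z\in E: q_x(z)<\infty\}$ be as defined in the context. Then: (i) $\mu(E_x)=1$. (ii) For all $h\in H$ we have $q_x(h)\le \sqrt3\,|h|$. In particular, $H\subset E_x$ continuously. (iii) For all $z\in E$ we have $\|z\|\le \sqrt2\, q_x(z)$. In particular, $(E_x,q_x)$ is complete. Furthermore, $(E_x,q_x)$ is compactly embedded into $(E,\|\cdot\|)$. (iv) $(E_x,H,\mu)$ is an abstract Wiener space (where $E_x$ carries the norm $q_x$). In particular, $q_x\in L^2(E,\mu)$.
   Context: Abstract Wiener space $(E,H,\mu)$: $(H,\langle\cdot,\cdot\rangle)$ is a separable real Hilbert space with norm $|\cdot|$, continuously and densely embedded into a Banach space $(E,\|\cdot\|)$; identifying $H$ with its dual, $E'\subset H\subset E$ continuously and densely; and $\mu$ is a Gaussian probability measure on the Borel $\sigma$-algebra $\mathcal B$ of $E$ such that every $l\in E'$ is, under $\mu$, normally distributed with mean $0$ and variance $|l|^2$ (the $H$-norm of $l\in E'\subset H$). Write ${}_{E'}\langle l,z\rangle_E=l(z)$. Fix $x\in E\setminus H$ (so $\dim H=\infty$). Fix an orthonormal basis $\{e_n^x: n\ge1\}$ of $H$ with $e_n^x\in E'$ for all $n$, which separates the points of $E$ and satisfies ${}_{E'}\langle e_n^x,x\rangle_E\ge 2^{n/2}$ for all $n$ (such a basis exists). Let $\widetilde P_n z=\sum_{k=1}^n {}_{E'}\langle e_k^x,z\rangle_E\,e_k^x$,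 $z\in E$. Let $(\widetilde Q_n)_{n\ge1}$ be a subsequence of $(\widetilde P_n)_{n\ge 1}$, with restrictions $Q_n:=\widetilde Q_n|_H$, such that for all $n\ge1$ $$\|\mathrm{Id}_H-Q_n\|_{\mathcal L(H,E)}\le 2^{-n},\qquad \mu(\{z\in E:\|z-\widetilde Q_nz\|>2^{-n}\})\le 2^{-n}$$ (such a subsequence exists), and set $\widetilde Q_0:=0$. Define $$q_x(z):=\Big[\sum_{n\ge0}2^n\|\widetilde Q_{n+1}z-\widetilde Q_nz\|^2+\Big(\sum_{n\ge1}2^{-n/2}|{}_{E'}\langle e_n^x,z\rangle_E|\Big)^2\Big]^{1/2},\quad z\in E,$$ and $E_x:=\{z\in E: q_x(z)<\infty\}$, a linear subspace of $E$ normed by $q_x$.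
   Formalization: In (ii) the bound q_x(h) ≤ √3|h| is proved under the normalization ‖h‖ ≤ |h| on H, since it fails after scaling ‖·‖ by a large factor; in general q_x(h) ≤ √3·max(1, ‖Id‖_{L(H,E)})·|h| is proved. *)

theory Defs
  imports "HOL-Probability.Probability"
begin

(* Banach spaces are given by a carrier V inside an ambient real vector space and a norm N on V,
   because E_x is a subspace of E with a different norm. E itself is the case V = UNIV, N = norm. *)

definition normed_on :: "'e::real_vector set \<Rightarrow> ('e \<Rightarrow> real) \<Rightarrow> bool" where
  "normed_on V N \<longleftrightarrow> subspace V \<and>
     (\<forall>v\<in>V. 0 \<le> N v \<and> (N v = 0 \<longleftrightarrow> v = 0)) \<and>
     (\<forall>v\<in>V. \<forall>c. N (c *\<^sub>R v) = \<bar>c\<bar> * N v) \<and>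
     (\<forall>v\<in>V. \<forall>w\<in>V. N (v + w) \<le> N v + N w)"

abbreviation (input) norm_dist :: "('e::real_vector \<Rightarrow> real) \<Rightarrow> 'e \<Rightarrow> 'e \<Rightarrow> real" where
  "norm_dist N \<equiv> \<lambda>v w. N (v - w)"

abbreviation (input) norm_topology :: "'e::real_vector set \<Rightarrow> ('e \<Rightarrow> real) \<Rightarrow> 'e topology" where
  "norm_topology V N \<equiv> Metric_space.mtopology V (norm_dist N)"

definition banach_on :: "'e::real_vector set \<Rightarrow> ('e \<Rightarrow> real) \<Rightarrow> bool" where
  "banach_on V N \<longleftrightarrow> normed_on V N \<and> Metric_space.mcomplete V (norm_dist N)"

(* Values of a functional outside V are irrelevant. *)
definition dual_on :: "'e::real_vector set \<Rightarrow> ('e \<Rightarrow> real) \<Rightarrow> ('e \<Rightarrow> real) set" where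
  "dual_on V N = {l. (\<forall>v\<in>V. \<forall>w\<in>V. l (v + w) = l v + l w) \<and>
                     (\<forall>v\<in>V. \<forall>c. l (c *\<^sub>R v) = c * l v) \<and>
                     (\<exists>C. \<forall>v\<in>V. \<bar>l v\<bar> \<le> C * N v)}"

(* The inclusion of E' into H (identified with its dual): l is sent to the Riesz representative
   of its restriction to H, where H is embedded into E by \<iota>. *)
definition dual_embed :: "('h::real_inner \<Rightarrow> 'e) \<Rightarrow> ('e \<Rightarrow> real) \<Rightarrow> 'h" where
  "dual_embed \<iota> l = (THE h. \<forall>k. l (\<iota> k) = inner h k)"

(* normal_density _ 0 is not a probability density, so the degenerate case is a point mass. *)
definition normal_law :: "real \<Rightarrow> real \<Rightarrow> real measure" where
  "normal_law m s = (if s = 0 then return borel m else density lborel (normal_density m s))"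

(* Density of E' in H is not listed: it follows from injectivity of \<iota>. *)
definition abstract_wiener_space ::
  "'e::real_vector set \<Rightarrow> ('e \<Rightarrow> real) \<Rightarrow> ('h::{real_inner,complete_space} \<Rightarrow> 'e) \<Rightarrow> 'e measure \<Rightarrow> bool"
where
  "abstract_wiener_space V N \<iota> M \<longleftrightarrow>
     banach_on V N \<and>
     separable_space (euclidean :: 'h topology) \<and>
     linear \<iota> \<and> inj \<iota> \<and> range \<iota> \<subseteq> V \<and>
     (\<exists>C. \<forall>h. N (\<iota> h) \<le> C * norm h) \<and>
     norm_topology V N closure_of range \<iota> = V \<and>
     space M = V \<and>
     sets M = sigma_sets V {U. openin (norm_topology V N) U} \<and>
     prob_space M \<and>
     (\<forall>l \<in> dual_on V N. distr M borel l = normal_law 0 (norm (dual_embed \<iota> l)))"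

(* Bases are indexed by n \<ge> 1; the value at 0 is never used. *)
definition orthonormal_basis :: "(nat \<Rightarrow> 'h::real_inner) \<Rightarrow> bool" where
  "orthonormal_basis b \<longleftrightarrow>
     (\<forall>m\<ge>1. \<forall>n\<ge>1. inner (b m) (b n) = (if m = n then 1 else 0)) \<and>
     closure (span (b ` {1..})) = UNIV"

definition P_tilde ::
  "('h::real_inner \<Rightarrow> 'e::real_normed_vector) \<Rightarrow> (nat \<Rightarrow> 'e \<Rightarrow>\<^sub>L real) \<Rightarrow> nat \<Rightarrow> 'e \<Rightarrow> 'e" where
  "P_tilde \<iota> e n z = (\<Sum>k=1..n. e k z *\<^sub>R \<iota> (dual_embed \<iota> (e k)))"

(* The subsequence is n \<mapsto> r n for n \<ge> 1, with r strictly increasing. *)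
definition Q_tilde ::
  "('h::real_inner \<Rightarrow> 'e::real_normed_vector) \<Rightarrow> (nat \<Rightarrow> 'e \<Rightarrow>\<^sub>L real) \<Rightarrow> (nat \<Rightarrow> nat) \<Rightarrow> nat \<Rightarrow> 'e \<Rightarrow> 'e"
where
  "Q_tilde \<iota> e r n z = (if n = 0 then 0 else P_tilde \<iota> e (r n) z)"

definition ennreal_sqrt :: "ennreal \<Rightarrow> ennreal" where
  "ennreal_sqrt t = (if t = \<infinity> then \<infinity> else ennreal (sqrt (enn2real t)))"

definition q_fun ::
  "('h::real_inner \<Rightarrow> 'e::real_normed_vector) \<Rightarrow> (nat \<Rightarrow> 'e \<Rightarrow>\<^sub>L real) \<Rightarrow> (nat \<Rightarrow> nat) \<Rightarrow> 'e \<Rightarrow> ennreal"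
where
  "q_fun \<iota> e r z = ennreal_sqrt (
     (\<Sum>n. ennreal (2 ^ n * (norm (Q_tilde \<iota> e r (Suc n) z - Q_tilde \<iota> e r n z))\<^sup>2)) +
     (\<Sum>n. ennreal (2 powr (- real (Suc n) / 2) * \<bar>e (Suc n) z\<bar>))\<^sup>2)"

definition E_sub ::
  "('h::real_inner \<Rightarrow> 'e::real_normed_vector) \<Rightarrow> (nat \<Rightarrow> 'e \<Rightarrow>\<^sub>L real) \<Rightarrow> (nat \<Rightarrow> nat) \<Rightarrow> 'e set"
where
  "E_sub \<iota> e r = {z. q_fun \<iota> e r z < \<infinity>}"

definition q_norm ::
  "('h::real_inner \<Rightarrow> 'e::real_normed_vector) \<Rightarrow> (nat \<Rightarrow> 'e \<Rightarrow>\<^sub>L real) \<Rightarrow> (nat \<Rightarrow> nat) \<Rightarrow> 'e \<Rightarrow> real"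
where
  "q_norm \<iota> e r z = enn2real (q_fun \<iota> e r z)"

end

(* Truncating both sums writes q as the supremum of continuous seminorms part N; hence q is a lower
   semicontinuous norm on E_x. On H, each block Q_{n+1} h - Q_n h is killed by Q_n, so its norm in E is at
   most 2^{-n} times its norm in H, and Bessel's inequality gives (ii). Cauchy-Schwarz against the weights
   2^n gives |z - Q_n z| <= sqrt (2 * 2^{-n}) q(z); with lower semicontinuity this gives completeness, and with
   the finite rank of Q_n compactness. The Borel-Cantelli lemma and E|e_n| = const give (i).

   Since q(z - Q_n z) -> 0, a functional l bounded for q is the pointwise limit on E_x of l o Q_n, which
   lies in E'; convergence of the characteristic functions shows that l is Gaussian with variance |l|^2.

   Square integrability of q is Fernique's argument: (z, z') -> ((z + z') / sqrt 2, (z - z') / sqrt 2) preserves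
   the joint law of all coordinates under mu x mu, which follows from the Cramer-Wold theorem, and this
   gives P(q <= s) P(q > t) <= P(q > (t - s) / sqrt 2)^2 and so rapid decay of the tail of q. *)
theory Submission imports Defs begin

section \<open>The Cramer-Wold theorem\<close>

text \<open>An abstract Wiener space prescribes only the laws of single functionals. These determine
  joint laws because linear combinations of functionals are functionals again, which is why the
  Cramer-Wold theorem is proved for families indexed linearly by a vector space. The rotation then
  acts on coordinate sequences and never on an \<open>'e\<close>-valued random variable; since
  \<open>q\<close> depends on the coordinates alone, that is enough. The weight 2^n fits between two
  estimates. Squared block norms are of order 4^(-n), on H as well as eventually almost surely, so
  the weighted series still converges; and the reciprocal weights 2^(-n) are summable, as
  Cauchy-Schwarz requires. The block n = 0 is exceptional: Q_0 = 0 is not close to the identity, so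
  the operator norm of \<open>\<iota>\<close> enters (ii) there. Besides Gaussian laws, (iv)
  requires the Borel sets of the stronger norm on E_x to be the traces of the Borel sets of E. This
  rests on the separability of H.\<close>

lemma weighted_char_unique:
  fixes X :: "'a \<Rightarrow> real" and Y :: "'b \<Rightarrow> real"
  assumes M: "finite_measure M" and N: "finite_measure N"
    and [measurable]: "X \<in> borel_measurable M" "V \<in> borel_measurable M"
      "Y \<in> borel_measurable N" "W \<in> borel_measurable N"
    and V: "\<And>\<omega>. 0 \<le> V \<omega>" "\<And>\<omega>. V \<omega> \<le> C" and W: "\<And>\<omega>. 0 \<le> W \<omega>" "\<And>\<omega>. W \<omega> \<le> C"
    and char: "\<And>t. (CLINT \<omega>|M. V \<omega> *\<^sub>R iexp (t * X \<omega>)) = (CLINT \<omega>|N. W \<omega> *\<^sub>R iexp (t * Y \<omega>))"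
    and A: "A \<in> sets borel"
  shows "(\<integral>\<omega>. V \<omega> * indicator A (X \<omega>) \<partial>M) = (\<integral>\<omega>. W \<omega> * indicator A (Y \<omega>) \<partial>N)"
proof -
  interpret M: finite_measure M by fact
  interpret N: finite_measure N by fact
  have iV: "integrable M V" by (rule M.integrable_const_bound[where B=C]) (use V in auto)
  have iW: "integrable N W" by (rule N.integrable_const_bound[where B=C]) (use W in auto)
  define m where "m = (\<integral>\<omega>. V \<omega> \<partial>M)"
  \<comment> \<open>At t = 0 the transform is the total mass, so both weighted measures have mass
    \<open>m\<close>.\<close>
  have "complex_of_real m = (CLINT \<omega>|M. V \<omega> *\<^sub>R iexp (0 * X \<omega>))"
    using iV by (simp add: m_def scaleR_conv_of_real)
  also have "\<dots> = complex_of_real (\<integral>\<omega>. W \<omega> \<partial>N)"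
    unfolding char using iW by (simp add: scaleR_conv_of_real)
  finally have m': "m = (\<integral>\<omega>. W \<omega> \<partial>N)" by (simp only: of_real_eq_iff)
  have m0: "0 \<le> m" by (simp add: m_def V)
  show ?thesis
  \<comment> \<open>Levy's uniqueness theorem concerns probability measures, so the weighted
    measures are divided by \<open>m\<close>; for mass 0 both weights vanish almost
    everywhere.\<close>
  proof (cases "m = 0")
    case True
    have "AE \<omega> in M. V \<omega> = 0"
      using True iV V unfolding m_def by (subst (asm) integral_nonneg_eq_0_iff_AE) auto
    moreover have "AE \<omega> in N. W \<omega> = 0"
      using True iW W unfolding m' by (subst (asm) integral_nonneg_eq_0_iff_AE) auto
    ultimately have "(\<integral>\<omega>. V \<omega> * indicator A (X \<omega>) \<partial>M) = 0" "(\<integral>\<omega>. W \<omega> * indicator A (Y \<omega>) \<partial>N) = 0"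
      by (auto intro!: integral_eq_zero_AE elim!: eventually_mono)
    then show ?thesis by simp
  next
    case False
    with m0 have m: "m > 0" by simp
    \<comment> \<open>Stated for an arbitrary \<open>K\<close> because \<open>M\<close> and
      \<open>N\<close> live over different types.\<close>
    have *: "real_distribution (distr (density K (\<lambda>\<omega>. ennreal (U \<omega> / m))) borel Z) \<and>
        (\<forall>t. char (distr (density K (\<lambda>\<omega>. ennreal (U \<omega> / m))) borel Z) t
            = (CLINT \<omega>|K. U \<omega> *\<^sub>R iexp (t * Z \<omega>)) / m) \<and>
        measure (distr (density K (\<lambda>\<omega>. ennreal (U \<omega> / m))) borel Z) A
            = (\<integral>\<omega>. U \<omega> * indicator A (Z \<omega>) \<partial>K) / m"
      if [measurable]: "Z \<in> borel_measurable K" "U \<in> borel_measurable K"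
        and U: "\<And>\<omega>. 0 \<le> U \<omega>" "integrable K U" "(\<integral>\<omega>. U \<omega> \<partial>K) = m" for K :: "'c measure" and Z U
    proof -
      let ?D = "density K (\<lambda>\<omega>. ennreal (U \<omega> / m))"
      have "emeasure ?D (space ?D) = (\<integral>\<^sup>+\<omega>. ennreal (U \<omega> / m) \<partial>K)"
        by (simp add: emeasure_density cong: nn_integral_cong)
      also have "\<dots> = ennreal (\<integral>\<omega>. U \<omega> / m \<partial>K)"
        using U m by (intro nn_integral_eq_integral) auto
      also have "\<dots> = 1" using U m by simp
      finally interpret D: prob_space ?D by (rule prob_spaceI)
      have R: "real_distribution (distr ?D borel Z)" by (rule D.real_distribution_distr) simp
      have C: "char (distr ?D borel Z) t = (CLINT \<omega>|K. U \<omega> *\<^sub>R iexp (t * Z \<omega>)) / m" for t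
      proof -
        have "char (distr ?D borel Z) t = (CLINT \<omega>|?D. iexp (t * Z \<omega>))"
          unfolding char_def by (subst integral_distr) auto
        also have "\<dots> = (CLINT \<omega>|K. (U \<omega> / m) *\<^sub>R iexp (t * Z \<omega>))"
          using U m by (subst integral_density) auto
        also have "\<dots> = (CLINT \<omega>|K. (U \<omega> *\<^sub>R iexp (t * Z \<omega>)) / m)"
          by (simp add: scaleR_conv_of_real)
        finally show ?thesis by simp
      qed
      have "measure (distr ?D borel Z) A = (\<integral>x. indicator A x \<partial>distr ?D borel Z)"
        using A by simp
      also have "\<dots> = (\<integral>\<omega>. indicator A (Z \<omega>) \<partial>?D)"
        using A by (subst integral_distr) auto
      also have "\<dots> = (\<integral>\<omega>. U \<omega> / m * indicator A (Z \<omega>) \<partial>K)"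
        using U m A by (subst integral_density) auto
      finally show ?thesis using R C by simp
    qed
    note PV = *[OF _ _ V(1) iV m_def[symmetric]] and QW = *[OF _ _ W(1) iW m'[symmetric]]
    have "distr (density M (\<lambda>\<omega>. ennreal (V \<omega> / m))) borel X = distr (density N (\<lambda>\<omega>. ennreal (W \<omega> / m))) borel Y"
      using PV[of X] QW[of Y] char by (intro Levy_uniqueness) auto
    then show ?thesis using PV[of X] QW[of Y] m by simp
  qed
qed

text \<open>By induction on \<open>J\<close>. For every \<open>v\<close> and phase \<open>c\<close>, the weights
  \<open>(\<Prod>i\<in>J. indicator (A i) (X (u i) \<omega>)) * (1 + cos (X v \<omega> + c))\<close> are nonnegative, so
  \<open>weighted_char_unique\<close> applies to one further coordinate; the phases \<open>0\<close> and \<open>-pi/2\<close> recover the complex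
  exponential.\<close>

lemma cramer_wold_boxes:
  fixes X :: "'v::real_vector \<Rightarrow> 'a \<Rightarrow> real" and Y :: "'v \<Rightarrow> 'b \<Rightarrow> real" and u :: "'i \<Rightarrow> 'v"
  assumes M: "prob_space M" and N: "prob_space N"
    and Xm[measurable]: "\<And>v. X v \<in> borel_measurable M"
    and Ym[measurable]: "\<And>v. Y v \<in> borel_measurable N"
    and linX: "\<And>\<omega>. linear (\<lambda>v. X v \<omega>)" and linY: "\<And>\<omega>. linear (\<lambda>v. Y v \<omega>)"
    and char: "\<And>v. (CLINT \<omega>|M. iexp (X v \<omega>)) = (CLINT \<omega>|N. iexp (Y v \<omega>))"
    and J: "finite J" and A[measurable]: "\<And>i. A i \<in> sets borel"
  shows "(CLINT \<omega>|M. (\<Prod>i\<in>J. indicator (A i) (X (u i) \<omega>)) *\<^sub>R iexp (X v \<omega>)) =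
         (CLINT \<omega>|N. (\<Prod>i\<in>J. indicator (A i) (Y (u i) \<omega>)) *\<^sub>R iexp (Y v \<omega>))"
  using J
proof (induction J arbitrary: v rule: finite_induct)
  case empty
  then show ?case using char by simp
next
  case (insert w J)
  define a where "a \<omega> = (\<Prod>i\<in>J. indicator (A i) (X (u i) \<omega>) :: real)" for \<omega>
  define b where "b \<omega> = (\<Prod>i\<in>J. indicator (A i) (Y (u i) \<omega>) :: real)" for \<omega>
  have IH: "(CLINT \<omega>|M. a \<omega> *\<^sub>R iexp (X v \<omega>)) = (CLINT \<omega>|N. b \<omega> *\<^sub>R iexp (Y v \<omega>))" for v
    using insert.IH by (simp add: a_def b_def)
  have ab: "0 \<le> a \<omega>" "a \<omega> \<le> 1" "0 \<le> b \<omega>'" "b \<omega>' \<le> 1" for \<omega> \<omega>'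
    by (auto simp: a_def b_def intro!: prod_nonneg prod_le_1 simp: indicator_def)
  have meas[measurable]: "a \<in> borel_measurable M" "b \<in> borel_measurable N"
    unfolding a_def b_def by measurable
  have cos2: "0 \<le> 1 + cos x" "1 + cos x \<le> 2" for x :: real
    using cos_ge_minus_one[of x] cos_le_one[of x] by linarith+
  \<comment> \<open>Writing the cosine through exponentials leaves transforms with weight
    \<open>d\<close> alone, at the indices t z, t z + v and t z - v. The induction hypothesis covers
    all three because its index is arbitrary.\<close>
  have expand: "(CLINT \<omega>|K. (d \<omega> * (1 + cos (Z v \<omega> + c))) *\<^sub>R iexp (t * Z z \<omega>)) =
      (CLINT \<omega>|K. d \<omega> *\<^sub>R iexp (Z (t *\<^sub>R z) \<omega>))
      + iexp c / 2 * (CLINT \<omega>|K. d \<omega> *\<^sub>R iexp (Z (t *\<^sub>R z + v) \<omega>))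
      + iexp (-c) / 2 * (CLINT \<omega>|K. d \<omega> *\<^sub>R iexp (Z (t *\<^sub>R z - v) \<omega>))"
    if K: "prob_space K" and Z[measurable]: "\<And>v. Z v \<in> borel_measurable K"
      and lin: "\<And>\<omega>. linear (\<lambda>v. Z v \<omega>)"
      and d[measurable]: "d \<in> borel_measurable K" "\<And>\<omega>. 0 \<le> d \<omega>" "\<And>\<omega>. d \<omega> \<le> 1"
    for K :: "'c measure" and Z :: "'v \<Rightarrow> 'c \<Rightarrow> real" and d v c t z
  proof -
    interpret K: prob_space K by fact
    have int: "integrable K (\<lambda>\<omega>. d \<omega> *\<^sub>R iexp (Z v \<omega>))" for v
      by (rule K.integrable_const_bound[where B=1]) (use d in auto)
    have "(d \<omega> * (1 + cos (Z v \<omega> + c))) *\<^sub>R iexp (t * Z z \<omega>) =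
      d \<omega> *\<^sub>R iexp (Z (t *\<^sub>R z) \<omega>) + iexp c / 2 * (d \<omega> *\<^sub>R iexp (Z (t *\<^sub>R z + v) \<omega>))
      + iexp (-c) / 2 * (d \<omega> *\<^sub>R iexp (Z (t *\<^sub>R z - v) \<omega>))" for \<omega>
    proof -
      have L: "Z (t *\<^sub>R z) \<omega> = t * Z z \<omega>" "Z (t *\<^sub>R z + v) \<omega> = t * Z z \<omega> + Z v \<omega>"
        "Z (t *\<^sub>R z - v) \<omega> = t * Z z \<omega> - Z v \<omega>"
        using linear_scale[OF lin, of t z \<omega>] linear_add[OF lin, of "t *\<^sub>R z" v \<omega>]
          linear_diff[OF lin, of "t *\<^sub>R z" v \<omega>] by auto
      have "complex_of_real (cos y) = (iexp y + iexp (- y)) / 2" for y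
        unfolding cos_of_real[symmetric] cos_exp_eq by simp
      then have "complex_of_real (cos (Z v \<omega> + c)) = (iexp (Z v \<omega> + c) + iexp (- (Z v \<omega> + c))) / 2" .
      also have "iexp (- (Z v \<omega> + c)) = iexp (-c) * iexp (- Z v \<omega>)"
        unfolding exp_add[symmetric] by (rule arg_cong[where f=exp]) (simp add: algebra_simps)
      also have "iexp (Z v \<omega> + c) = iexp c * iexp (Z v \<omega>)"
        unfolding exp_add[symmetric] by (rule arg_cong[where f=exp]) (simp add: algebra_simps)
      finally have C: "complex_of_real (cos (Z v \<omega> + c)) = (iexp c * iexp (Z v \<omega>) + iexp (-c) * iexp (- Z v \<omega>)) / 2" .
      have "iexp (t * Z z \<omega> + Z v \<omega>) = iexp (t * Z z \<omega>) * iexp (Z v \<omega>)"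
        "iexp (t * Z z \<omega> - Z v \<omega>) = iexp (t * Z z \<omega>) * iexp (- Z v \<omega>)"
        by (simp_all add: exp_add[symmetric] algebra_simps)
      then show ?thesis
        unfolding L scaleR_conv_of_real of_real_mult of_real_add C
        by (simp add: field_simps)
    qed
    moreover have i2: "integrable K (\<lambda>\<omega>. a * (d \<omega> *\<^sub>R iexp (Z v \<omega>)))" for a v
      by (intro integrable_mult_right int)
    ultimately show ?thesis
      by (simp only: Bochner_Integration.integral_add[OF Bochner_Integration.integrable_add[OF int i2] i2]
          Bochner_Integration.integral_add[OF int i2] integral_mult_right_zero)
  qed
  have key: "(\<integral>\<omega>. (a \<omega> * (1 + cos (X v \<omega> + c))) * indicator (A w) (X (u w) \<omega>) \<partial>M)
     = (\<integral>\<omega>. (b \<omega> * (1 + cos (Y v \<omega> + c))) * indicator (A w) (Y (u w) \<omega>) \<partial>N)" for v c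
  proof (rule weighted_char_unique[where C=2])
    show "finite_measure M" "finite_measure N" using M N by (auto intro: prob_space.finite_measure)
    show "0 \<le> a \<omega> * (1 + cos (X v \<omega> + c))" "a \<omega> * (1 + cos (X v \<omega> + c)) \<le> 2" for \<omega>
      using cos2[of "X v \<omega> + c"] ab(1,2)[of \<omega>] mult_mono[of "a \<omega>" 1 "1 + cos (X v \<omega> + c)" 2] by auto
    show "0 \<le> b \<omega> * (1 + cos (Y v \<omega> + c))" "b \<omega> * (1 + cos (Y v \<omega> + c)) \<le> 2" for \<omega>
      using cos2[of "Y v \<omega> + c"] ab(3,4)[of \<omega>] mult_mono[of "b \<omega>" 1 "1 + cos (Y v \<omega> + c)" 2] by auto
    show "(CLINT \<omega>|M. (a \<omega> * (1 + cos (X v \<omega> + c))) *\<^sub>R iexp (t * X (u w) \<omega>)) =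
          (CLINT \<omega>|N. (b \<omega> * (1 + cos (Y v \<omega> + c))) *\<^sub>R iexp (t * Y (u w) \<omega>))" for t
      by (simp only: expand[OF M Xm linX meas(1) ab(1,2)] expand[OF N Ym linY meas(2) ab(3,4)] IH)
  qed measurable
  define a' where "a' \<omega> = a \<omega> * indicator (A w) (X (u w) \<omega>)" for \<omega>
  define b' where "b' \<omega> = b \<omega> * indicator (A w) (Y (u w) \<omega>)" for \<omega>
  have [measurable]: "a' \<in> borel_measurable M" "b' \<in> borel_measurable N"
    unfolding a'_def b'_def by measurable
  have ab': "0 \<le> a' \<omega>" "a' \<omega> \<le> 1" "0 \<le> b' \<omega>'" "b' \<omega>' \<le> 1" for \<omega> \<omega>'
    using ab by (auto simp: a'_def b'_def indicator_def)
  interpret M: prob_space M by fact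
  interpret N: prob_space N by fact
  have iM: "integrable M (\<lambda>\<omega>. a' \<omega> * f \<omega>)" if "\<And>\<omega>. \<bar>f \<omega>\<bar> \<le> 1" "f \<in> borel_measurable M" for f
  proof (rule M.integrable_const_bound[where B=1])
    show "AE \<omega> in M. norm (a' \<omega> * f \<omega>) \<le> 1"
      using ab' that mult_mono[of "a' _" 1 "\<bar>f _\<bar>" 1] by (auto simp: abs_mult)
  qed (use that in measurable)
  have iN: "integrable N (\<lambda>\<omega>. b' \<omega> * f \<omega>)" if "\<And>\<omega>. \<bar>f \<omega>\<bar> \<le> 1" "f \<in> borel_measurable N" for f
  proof (rule N.integrable_const_bound[where B=1])
    show "AE \<omega> in N. norm (b' \<omega> * f \<omega>) \<le> 1"
      using ab' that mult_mono[of "b' _" 1 "\<bar>f _\<bar>" 1] by (auto simp: abs_mult)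
  qed (use that in measurable)
  have key': "(\<integral>\<omega>. a' \<omega> \<partial>M) + (\<integral>\<omega>. a' \<omega> * cos (X v \<omega> + c) \<partial>M)
     = (\<integral>\<omega>. b' \<omega> \<partial>N) + (\<integral>\<omega>. b' \<omega> * cos (Y v \<omega> + c) \<partial>N)" for v c
    using key[of v c] iM[of "\<lambda>_. 1"] iM[of "\<lambda>\<omega>. cos (X v \<omega> + c)"] iN[of "\<lambda>_. 1"] iN[of "\<lambda>\<omega>. cos (Y v \<omega> + c)"]
    by (simp add: a'_def b'_def algebra_simps)
  have "X 0 \<omega> = 0" "Y 0 \<omega>' = 0" for \<omega> \<omega>'
    using linear_0[OF linX] linear_0[OF linY] by auto
  \<comment> \<open>At index 0 the cosine is the constant cos c, which vanishes for c = pi/2. So the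
    plain masses agree and cancel from \<open>key'\<close>.\<close>
  then have e1: "(\<integral>\<omega>. a' \<omega> \<partial>M) = (\<integral>\<omega>. b' \<omega> \<partial>N)"
    using key'[of 0 "pi/2"] by simp
  have e2: "(\<integral>\<omega>. a' \<omega> * cos (X v \<omega>) \<partial>M) = (\<integral>\<omega>. b' \<omega> * cos (Y v \<omega>) \<partial>N)"
    using key'[of v 0] e1 by simp
  have e3: "(\<integral>\<omega>. a' \<omega> * sin (X v \<omega>) \<partial>M) = (\<integral>\<omega>. b' \<omega> * sin (Y v \<omega>) \<partial>N)"
    using key'[of v "-pi/2"] e1 by (simp add: cos_diff)
  have iexp: "iexp x = complex_of_real (cos x) + \<i> * complex_of_real (sin x)" for x :: real
    by (simp add: exp_Euler cos_of_real sin_of_real)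
  have "(CLINT \<omega>|M. a' \<omega> *\<^sub>R iexp (X v \<omega>)) =
      (CLINT \<omega>|M. complex_of_real (a' \<omega> * cos (X v \<omega>)) + \<i> * complex_of_real (a' \<omega> * sin (X v \<omega>)))"
    unfolding iexp by (simp add: scaleR_conv_of_real algebra_simps)
  also have "\<dots> = (CLINT \<omega>|M. complex_of_real (a' \<omega> * cos (X v \<omega>))) + \<i> * (CLINT \<omega>|M. complex_of_real (a' \<omega> * sin (X v \<omega>)))"
    using iM[of "\<lambda>\<omega>. cos (X v \<omega>)"] iM[of "\<lambda>\<omega>. sin (X v \<omega>)"]
    by (subst Bochner_Integration.integral_add) (auto simp del: of_real_mult)
  also have "\<dots> = (CLINT \<omega>|N. complex_of_real (b' \<omega> * cos (Y v \<omega>))) + \<i> * (CLINT \<omega>|N. complex_of_real (b' \<omega> * sin (Y v \<omega>)))"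
    unfolding integral_complex_of_real e2 e3 ..
  also have "\<dots> = (CLINT \<omega>|N. complex_of_real (b' \<omega> * cos (Y v \<omega>)) + \<i> * complex_of_real (b' \<omega> * sin (Y v \<omega>)))"
    using iN[of "\<lambda>\<omega>. cos (Y v \<omega>)"] iN[of "\<lambda>\<omega>. sin (Y v \<omega>)"]
    by (subst Bochner_Integration.integral_add) (auto simp del: of_real_mult)
  also have "\<dots> = (CLINT \<omega>|N. b' \<omega> *\<^sub>R iexp (Y v \<omega>))"
    unfolding iexp by (simp add: scaleR_conv_of_real algebra_simps)
  finally show ?case
    using insert.hyps by (simp add: a'_def b'_def a_def b_def mult_ac)
qed

text \<open>Every linear combination of the coordinates \<open>X (u i)\<close> is again some
  \<open>X v\<close>, so the one-dimensional transforms contain the joint ones. At index 0 the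
  exponential is 1 and \<open>cramer_wold_boxes\<close> yields the probabilities of
  finite-dimensional boxes, which determine a finite measure on the product.\<close>

theorem cramer_wold:
  fixes X :: "'v::real_vector \<Rightarrow> 'a \<Rightarrow> real" and Y :: "'v \<Rightarrow> 'b \<Rightarrow> real" and u :: "'i \<Rightarrow> 'v"
  assumes M: "prob_space M" and N: "prob_space N"
    and [measurable]: "\<And>v. X v \<in> borel_measurable M" "\<And>v. Y v \<in> borel_measurable N"
    and linX: "\<And>\<omega>. linear (\<lambda>v. X v \<omega>)" and linY: "\<And>\<omega>. linear (\<lambda>v. Y v \<omega>)"
    and char: "\<And>v. (CLINT \<omega>|M. iexp (X v \<omega>)) = (CLINT \<omega>|N. iexp (Y v \<omega>))"
  shows "distr M (Pi\<^sub>M UNIV (\<lambda>_. borel)) (\<lambda>\<omega> i. X (u i) \<omega>) = distr N (Pi\<^sub>M UNIV (\<lambda>_. borel)) (\<lambda>\<omega> i. Y (u i) \<omega>)"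
    (is "?P = ?Q")
proof (rule measure_eqI_PiM_infinite)
  interpret M: prob_space M by fact
  interpret N: prob_space N by fact
  have [measurable]: "(\<lambda>\<omega> i. X (u i) \<omega>) \<in> measurable M (Pi\<^sub>M UNIV (\<lambda>_. borel))"
    by (rule measurable_PiM_single') auto
  have [measurable]: "(\<lambda>\<omega> i. Y (u i) \<omega>) \<in> measurable N (Pi\<^sub>M UNIV (\<lambda>_. borel))"
    by (rule measurable_PiM_single') auto
  interpret P: prob_space ?P by (rule M.prob_space_distr) measurable
  show "finite_measure ?P" by (rule P.finite_measure)
  fix A :: "'i \<Rightarrow> real set" and J :: "'i set"
  assume J: "finite J" "J \<subseteq> UNIV" and A: "\<And>i. i \<in> J \<Longrightarrow> A i \<in> sets borel"
  \<comment> \<open>\<open>cramer_wold_boxes\<close> wants a Borel set at every index, while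
    \<open>A\<close> is controlled on \<open>J\<close> only.\<close>
  define B where "B i = (if i \<in> J then A i else UNIV)" for i
  have B[measurable]: "B i \<in> sets borel" for i using A by (simp add: B_def)
  have emb: "prod_emb UNIV (\<lambda>_. borel) J (Pi\<^sub>E J A) = {x. \<forall>i\<in>J. x i \<in> B i}"
    by (auto simp: prod_emb_def B_def PiE_iff)
  have box: "emeasure (distr K (Pi\<^sub>M UNIV (\<lambda>_. borel)) (\<lambda>\<omega> i. Z (u i) \<omega>)) {x. \<forall>i\<in>J. x i \<in> B i}
      = ennreal (Re (CLINT \<omega>|K. (\<Prod>i\<in>J. indicator (B i) (Z (u i) \<omega>)) *\<^sub>R iexp (Z 0 \<omega>)))"
    if K: "prob_space K" and [measurable]: "\<And>v. Z v \<in> borel_measurable K"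
      and lin: "\<And>\<omega>. linear (\<lambda>v. Z v \<omega>)" for K :: "'c measure" and Z
  proof -
    interpret K: prob_space K by fact
    have [measurable]: "(\<lambda>\<omega> i. Z (u i) \<omega>) \<in> measurable K (Pi\<^sub>M UNIV (\<lambda>_. borel))"
      by (rule measurable_PiM_single') auto
    have S: "{x. \<forall>i\<in>J. x i \<in> B i} \<in> sets (Pi\<^sub>M UNIV (\<lambda>_. borel :: real measure))"
      unfolding emb[symmetric] using J A by (intro sets_PiM_I) auto
    have "emeasure (distr K (Pi\<^sub>M UNIV (\<lambda>_. borel)) (\<lambda>\<omega> i. Z (u i) \<omega>)) {x. \<forall>i\<in>J. x i \<in> B i}
      = emeasure K {\<omega>\<in>space K. \<forall>i\<in>J. Z (u i) \<omega> \<in> B i}"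
      using S by (subst emeasure_distr) (auto intro!: arg_cong[where f="emeasure K"])
    also have "\<dots> = ennreal (\<integral>\<omega>. indicator {\<omega>\<in>space K. \<forall>i\<in>J. Z (u i) \<omega> \<in> B i} \<omega> \<partial>K)"
    proof -
      have "{\<omega>\<in>space K. \<forall>i\<in>J. Z (u i) \<omega> \<in> B i} \<in> sets K" using J by measurable
      then show ?thesis by (simp add: K.emeasure_eq_measure)
    qed
    also have "(\<integral>\<omega>. indicator {\<omega>\<in>space K. \<forall>i\<in>J. Z (u i) \<omega> \<in> B i} \<omega> \<partial>K) = (\<integral>\<omega>. (\<Prod>i\<in>J. indicator (B i) (Z (u i) \<omega>) :: real) \<partial>K)"
      using J by (intro Bochner_Integration.integral_cong) (auto simp: indicator_def prod_eq_1_iff)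
    also have "\<dots> = Re (CLINT \<omega>|K. (\<Prod>i\<in>J. indicator (B i) (Z (u i) \<omega>)) *\<^sub>R iexp (Z 0 \<omega>))"
    proof -
      have "Z 0 \<omega> = 0" for \<omega> using linear_0[OF lin] .
      then have "(CLINT \<omega>|K. (\<Prod>i\<in>J. indicator (B i) (Z (u i) \<omega>)) *\<^sub>R iexp (Z 0 \<omega>))
        = (CLINT \<omega>|K. complex_of_real (\<Prod>i\<in>J. indicator (B i) (Z (u i) \<omega>)))"
        by (simp add: scaleR_conv_of_real)
      then show ?thesis unfolding integral_complex_of_real by simp
    qed
    finally show ?thesis .
  qed
  show "emeasure ?P (prod_emb UNIV (\<lambda>_. borel) J (Pi\<^sub>E J A)) = emeasure ?Q (prod_emb UNIV (\<lambda>_. borel) J (Pi\<^sub>E J A))"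
    unfolding emb using J B linX linY M N
    by (simp add: box cramer_wold_boxes[OF M N _ _ linX linY char])
qed auto

section \<open>Fernique's tail estimate\<close>

text \<open>Once \<open>s\<close> is so large that q > s is unlikely, the inequality at (s, 2t)
  becomes F(2t) \<le> 2 F(t)^2. Iterated along doublings of T = 2s this makes the tail at 2^n T at
  most of order 16^(-n), which beats the growth 4^n of the square.\<close>

lemma fernique_second_moment:
  fixes q :: "'a \<Rightarrow> ennreal"
  assumes M: "prob_space M" and [measurable]: "q \<in> borel_measurable M"
    and fin: "AE \<omega> in M. q \<omega> < \<infinity>"
    and ineq: "\<And>s t. 0 \<le> s \<Longrightarrow> s \<le> t \<Longrightarrow>
      measure M {\<omega>\<in>space M. q \<omega> \<le> ennreal s} * measure M {\<omega>\<in>space M. q \<omega> > ennreal t}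
      \<le> (measure M {\<omega>\<in>space M. q \<omega> > ennreal ((t - s) / sqrt 2)})\<^sup>2"
  shows "(\<integral>\<^sup>+\<omega>. (q \<omega>)\<^sup>2 \<partial>M) < \<infinity>"
proof -
  interpret prob_space M by fact
  define F where "F t = measure M {\<omega>\<in>space M. q \<omega> > ennreal t}" for t
  have F_mono: "F t \<le> F s" if "s \<le> t" for s t
    unfolding F_def using that
    by (intro finite_measure_mono) (auto elim!: le_less_trans[rotated] intro!: ennreal_leI)
  have "(\<lambda>n. F (real n)) \<longlonglongrightarrow> measure M (\<Inter>n. {\<omega>\<in>space M. q \<omega> > ennreal (real n)})"
    unfolding F_def by (intro finite_Lim_measure_decseq)
      (auto simp: decseq_def elim!: le_less_trans[rotated] intro!: ennreal_leI)
  also have "(\<Inter>n. {\<omega>\<in>space M. q \<omega> > ennreal (real n)}) = {\<omega>\<in>space M. q \<omega> = \<infinity>}"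
  proof -
    have "q \<omega> = \<infinity>" if "\<forall>n. ennreal (real n) < q \<omega>" for \<omega>
    proof (rule ccontr)
      assume "q \<omega> \<noteq> \<infinity>"
      then have "q \<omega> < \<top>" by (simp add: less_top)
      then obtain n :: nat where "q \<omega> < of_nat n" using ennreal_Ex_less_of_nat by blast
      then show False using that by (metis ennreal_of_nat_eq_real_of_nat less_asym)
    qed
    then show ?thesis by auto
  qed
  also have "measure M {\<omega>\<in>space M. q \<omega> = \<infinity>} = 0"
    using fin by (subst prob_eq_0) (auto elim: eventually_mono)
  finally have "\<forall>\<^sub>F n in sequentially. F (real n) < 1/32"
    by (rule order_tendstoD) simp
  then obtain n0 where "\<And>n. n \<ge> n0 \<Longrightarrow> F (real n) < 1/32" by (auto simp: eventually_sequentially)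
  then have "F (real (Suc n0)) < 1/32" by (meson le_Suc_eq order_refl)
  \<comment> \<open>The successor keeps \<open>s\<close> positive even if \<open>n0\<close> is
    0.\<close>
  define s where "s = real (Suc n0)"
  have s: "s > 0" "F s < 1/32" using \<open>F (real (Suc n0)) < 1/32\<close> by (auto simp: s_def)
  have step: "F (2 * t) \<le> 2 * (F t)\<^sup>2" if "t \<ge> 2 * s" for t
  proof -
    have "measure M {\<omega>\<in>space M. q \<omega> \<le> ennreal s} = 1 - F s"
    proof -
      have "F s = prob (space M - {\<omega>\<in>space M. q \<omega> \<le> ennreal s})"
        unfolding F_def by (rule arg_cong[where f=prob]) auto
      then show ?thesis by (subst (asm) prob_compl) auto
    qed
    then have *: "(1 - F s) * F (2 * t) \<le> (F ((2 * t - s) / sqrt 2))\<^sup>2"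
      using ineq[of s "2 * t"] s that by (simp add: F_def)
    \<comment> \<open>The bound sqrt 2 \<le> 3/2 turns t \<ge> 2s into sqrt 2 * t \<le> 2t -
      s.\<close>
    have "t * sqrt 2 \<le> t * (3/2)"
      using that s by (intro mult_left_mono real_le_lsqrt) (auto simp: power2_eq_square)
    then have "t \<le> (2 * t - s) / sqrt 2" using that by (simp add: field_simps)
    then have "(F ((2 * t - s) / sqrt 2))\<^sup>2 \<le> (F t)\<^sup>2"
      by (intro power_mono F_mono) (auto simp: F_def)
    moreover have "1/2 * F (2 * t) \<le> (1 - F s) * F (2 * t)"
      using s by (intro mult_right_mono) (auto simp: F_def)
    ultimately show ?thesis using * by linarith
  qed
  define T where "T = 2 * s"
  \<comment> \<open>The threshold 1/32 was chosen for this: one factor F(t) \<le> 1/32 in 2 F(t)^2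
    leaves a gain of 1/16 per doubling.\<close>
  have decay: "F (2 ^ n * T) \<le> (1/32) * (1/16) ^ n" for n
  proof (induction n)
    case 0
    then show ?case using F_mono[of s T] s by (simp add: T_def)
  next
    case (Suc n)
    have "F (2 ^ Suc n * T) \<le> 2 * (F (2 ^ n * T))\<^sup>2"
      using step[of "2 ^ n * T"] s by (simp add: T_def mult.assoc)
    also have "\<dots> \<le> 2 * ((1/32) * F (2 ^ n * T))"
    proof -
      have "(1/32) * (1/16) ^ n \<le> (1/32 :: real)" by (simp add: power_le_one)
      then show ?thesis unfolding power2_eq_square
        using Suc by (intro mult_left_mono mult_right_mono) (auto simp: F_def)
    qed
    finally show ?case using Suc by simp
  qed
  \<comment> \<open>If 2^n T < q \<le> 2^(n+1) T, then q^2 is at most the n-th summand. The other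
    summands are nonnegative, so no disjointness of the shells is needed.\<close>
  have pt: "(q \<omega>)\<^sup>2 \<le> ennreal (T\<^sup>2) + (\<Sum>n. ennreal (4 ^ Suc n * T\<^sup>2) * indicator {\<omega>\<in>space M. q \<omega> > ennreal (2 ^ n * T)} \<omega>)"
    if \<omega>: "\<omega> \<in> space M" and "q \<omega> < \<infinity>" for \<omega>
  proof -
    obtain c where c: "q \<omega> = ennreal c" "c \<ge> 0" using \<open>q \<omega> < \<infinity>\<close> by (cases "q \<omega>") auto
    have "\<exists>n. c \<le> 2 ^ n * T"
    proof -
      obtain n where "c / T < 2 ^ n" using real_arch_pow[of 2 "c / T"] by auto
      then show ?thesis using s by (intro exI[of _ n]) (simp add: T_def field_simps)
    qed
    define m where "m = (LEAST n. c \<le> 2 ^ n * T)"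
    have m: "c \<le> 2 ^ m * T" unfolding m_def by (rule LeastI_ex) fact
    show ?thesis
    proof (cases m)
      case 0
      then have "c\<^sup>2 \<le> T\<^sup>2" using m c by (intro power_mono) auto
      then have "(q \<omega>)\<^sup>2 \<le> ennreal (T\<^sup>2)"
        unfolding c(1) ennreal_power[OF c(2)] by (rule ennreal_leI)
      then show ?thesis by (rule add_increasing2[OF zero_le])
    next
      case (Suc n)
      have "\<not> c \<le> 2 ^ n * T" using not_less_Least[of n "\<lambda>n. c \<le> 2 ^ n * T"] Suc unfolding m_def by simp
      moreover have "0 < 2 ^ n * T" using s by (simp add: T_def)
      ultimately have ind: "ennreal (2 ^ n * T) < q \<omega>"
        unfolding c(1) by (intro ennreal_lessI) auto
      have "c\<^sup>2 \<le> (2 ^ m * T)\<^sup>2" using m c by (intro power_mono) auto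
      also have "\<dots> = 4 ^ Suc n * T\<^sup>2"
        unfolding Suc by (simp add: power_mult_distrib power2_eq_square flip: power_mult_distrib)
      finally have "(q \<omega>)\<^sup>2 \<le> ennreal (4 ^ Suc n * T\<^sup>2)"
        unfolding c(1) ennreal_power[OF c(2)] by (rule ennreal_leI)
      also have "\<dots> = (\<Sum>n\<in>{n}. ennreal (4 ^ Suc n * T\<^sup>2) * indicator {\<omega>\<in>space M. q \<omega> > ennreal (2 ^ n * T)} \<omega>)"
        using ind \<omega> by simp
      also have "\<dots> \<le> (\<Sum>n. ennreal (4 ^ Suc n * T\<^sup>2) * indicator {\<omega>\<in>space M. q \<omega> > ennreal (2 ^ n * T)} \<omega>)"
        by (intro sum_le_suminf) auto
      finally show ?thesis by (rule add_increasing[OF zero_le])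
    qed
  qed
  have "(\<integral>\<^sup>+\<omega>. (q \<omega>)\<^sup>2 \<partial>M) \<le> (\<integral>\<^sup>+\<omega>. ennreal (T\<^sup>2) +
      (\<Sum>n. ennreal (4 ^ Suc n * T\<^sup>2) * indicator {\<omega>\<in>space M. q \<omega> > ennreal (2 ^ n * T)} \<omega>) \<partial>M)"
    using fin pt by (intro nn_integral_mono_AE) auto
  also have "\<dots> = ennreal (T\<^sup>2) + (\<Sum>n. ennreal (4 ^ Suc n * T\<^sup>2) * emeasure M {\<omega>\<in>space M. q \<omega> > ennreal (2 ^ n * T)})"
    by (simp add: nn_integral_add nn_integral_suminf nn_integral_cmult emeasure_space_1)
  also have "\<dots> \<le> ennreal (T\<^sup>2) + (\<Sum>n. ennreal (4 * T\<^sup>2 * (1/4) ^ n))"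
  proof (intro add_left_mono suminf_le)
    fix n
    have "ennreal (4 ^ Suc n * T\<^sup>2) * emeasure M {\<omega>\<in>space M. q \<omega> > ennreal (2 ^ n * T)}
        = ennreal (4 ^ Suc n * T\<^sup>2 * F (2 ^ n * T))"
      by (simp add: F_def emeasure_eq_measure ennreal_mult)
    also have "\<dots> \<le> ennreal (4 ^ Suc n * T\<^sup>2 * (1/16) ^ n)"
    proof (intro ennreal_leI mult_left_mono)
      have "0 \<le> F (2 ^ n * T)" by (simp add: F_def)
      then show "F (2 ^ n * T) \<le> (1/16) ^ n" using decay[of n] by linarith
    qed simp
    also have "4 ^ Suc n * T\<^sup>2 * (1/16) ^ n = 4 * T\<^sup>2 * (1/4 :: real) ^ n"
    proof -
      have "(4::real) ^ n * (1/16) ^ n = (1/4) ^ n" by (simp flip: power_mult_distrib)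
      then show ?thesis by (simp add: mult_ac)
    qed
    finally show "ennreal (4 ^ Suc n * T\<^sup>2) * emeasure M {\<omega>\<in>space M. q \<omega> > ennreal (2 ^ n * T)}
      \<le> ennreal (4 * T\<^sup>2 * (1/4) ^ n)" .
  qed auto
  also have "(\<Sum>n. ennreal (4 * T\<^sup>2 * (1/4) ^ n)) < \<infinity>"
    by (subst suminf_ennreal2) (auto intro!: summable_mult summable_geometric)
  finally show ?thesis by (simp add: less_top)
qed

section \<open>Orthonormal expansions\<close>

text \<open>The index 0 is excluded because an \<open>orthonormal_basis\<close> says nothing about
  its value there.\<close>

lemma norm_sum_orthonormal:
  assumes b: "orthonormal_basis b" and K: "finite K" "0 \<notin> K"
  shows "(norm (\<Sum>k\<in>K. c k *\<^sub>R b k))\<^sup>2 = (\<Sum>k\<in>K. (c k)\<^sup>2)"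
proof -
  have "inner (c j *\<^sub>R b j) (c k *\<^sub>R b k) = (if k = j then (c j)\<^sup>2 else 0)" if "j \<in> K" "k \<in> K" for j k
  proof -
    have "j \<noteq> 0" "k \<noteq> 0" using that K by metis+
    then have "inner (b j) (b k) = (if j = k then 1 else 0)"
      using b unfolding orthonormal_basis_def by (simp add: Suc_le_eq)
    then show ?thesis by (simp add: power2_eq_square)
  qed
  then have "(\<Sum>j\<in>K. \<Sum>k\<in>K. inner (c j *\<^sub>R b j) (c k *\<^sub>R b k)) = (\<Sum>j\<in>K. (c j)\<^sup>2)"
    using K by (intro sum.cong) simp_all
  then show ?thesis
    unfolding power2_norm_eq_inner inner_sum_left by (simp only: inner_sum_right)
qed

text \<open>Riesz representation and Fourier expansion in one. The partial sums satisfy f(S n) = |S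
  n|^2 \<le> C |S n|, so the squares of the coefficients are summable and \<open>S\<close> is
  Cauchy; its limit represents \<open>f\<close> on the basis, hence on the closed span.\<close>

lemma orthonormal_expansion:
  fixes b :: "nat \<Rightarrow> 'h::{real_inner,complete_space}" and f :: "'h \<Rightarrow> real"
  assumes b: "orthonormal_basis b" and f: "bounded_linear f"
  shows "\<exists>h. (\<lambda>n. \<Sum>k=1..n. f (b k) *\<^sub>R b k) \<longlonglongrightarrow> h \<and> (\<forall>k. f k = inner h k)"
proof -
  interpret f: bounded_linear f by fact
  define S where "S n = (\<Sum>k=1..n. f (b k) *\<^sub>R b k)" for n
  define a where "a n = (\<Sum>k=1..n. (f (b k))\<^sup>2)" for n
  obtain C where C: "\<And>h. norm (f h) \<le> norm h * C" "C > 0" using f.pos_bounded by blast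
  have nS: "(norm (S n))\<^sup>2 = a n" for n
    unfolding S_def a_def by (intro norm_sum_orthonormal b) auto
  have fS: "f (S n) = a n" for n
    by (simp add: S_def a_def f.sum f.scaleR power2_eq_square)
  have "a n \<le> C\<^sup>2" for n
  proof (cases "norm (S n) = 0")
    case True
    then show ?thesis using nS[of n] by (metis zero_le_power2 zero_power2)
  next
    case False
    have "norm (S n) * norm (S n) \<le> norm (S n) * C"
      using C(1)[of "S n"] fS[of n] nS[of n] by (simp add: power2_eq_square abs_le_iff)
    then have "norm (S n) \<le> C" using False by simp
    then show ?thesis using nS[of n] by (metis norm_ge_zero power_mono)
  qed
  moreover have "incseq a"
    unfolding a_def by (intro monoI sum_mono2) auto
  ultimately have "convergent a"
    by (intro Bseq_monoseq_convergent BseqI'[of a "C\<^sup>2"]) (auto simp: a_def sum_nonneg incseq_def monoseq_def)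
  then have aC: "Cauchy a" by (rule convergent_Cauchy)
  have diff: "(norm (S n - S m))\<^sup>2 = a n - a m" if "m \<le> n" for m n
  proof -
    have E: "{1..n} = {1..m} \<union> {m<..n}" using that by auto
    have "S n - S m = (\<Sum>k\<in>{m<..n}. f (b k) *\<^sub>R b k)" "a n - a m = (\<Sum>k\<in>{m<..n}. (f (b k))\<^sup>2)"
      unfolding S_def a_def E by (subst sum.union_disjoint; auto)+
    then show ?thesis using norm_sum_orthonormal[OF b, of "{m<..n}" "\<lambda>k. f (b k)"] by simp
  qed
  have "Cauchy S"
    unfolding Cauchy_altdef
  proof (intro allI impI)
    fix \<epsilon> :: real assume \<epsilon>: "\<epsilon> > 0"
    then obtain M where M: "\<And>m n. m \<ge> M \<Longrightarrow> n > m \<Longrightarrow> dist (a m) (a n) < \<epsilon>\<^sup>2"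
      using aC unfolding Cauchy_altdef by (meson zero_less_power)
    have "dist (S m) (S n) < \<epsilon>" if "m \<ge> M" "n > m" for m n
    proof -
      have "(dist (S m) (S n))\<^sup>2 < \<epsilon>\<^sup>2"
        using M[OF that] diff[of m n] that by (simp add: dist_norm norm_minus_commute abs_minus_commute)
      then show ?thesis using \<epsilon> by (simp add: power_less_imp_less_base)
    qed
    then show "\<exists>M. \<forall>m\<ge>M. \<forall>n>m. dist (S m) (S n) < \<epsilon>" by blast
  qed
  then obtain h where h: "S \<longlonglongrightarrow> h" using Cauchy_convergent convergent_def by blast
  have hb: "inner h (b j) = f (b j)" if "j \<ge> 1" for j
  proof -
    have "\<forall>\<^sub>F n in sequentially. inner (S n) (b j) = f (b j)"
      using eventually_ge_at_top[of j]
    proof eventually_elim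
      case (elim n)
      have "inner (S n) (b j) = (\<Sum>k=1..n. if k = j then f (b j) else 0)"
        unfolding S_def inner_sum_left
        using b that by (intro sum.cong) (auto simp: orthonormal_basis_def)
      also have "\<dots> = f (b j)" using that elim by simp
      finally show ?case .
    qed
    then have "(\<lambda>n. inner (S n) (b j)) \<longlonglongrightarrow> f (b j)" by (rule tendsto_eventually)
    moreover have "(\<lambda>n. inner (S n) (b j)) \<longlonglongrightarrow> inner h (b j)" by (intro tendsto_intros h)
    ultimately show ?thesis by (rule LIMSEQ_unique[symmetric])
  qed
  let ?T = "{k. f k = inner h k}"
  have "closed ?T"
    by (intro closed_Collect_eq continuous_intros linear_continuous_on f)
  moreover have "span (b ` {1..}) \<subseteq> ?T"
    by (rule span_minimal) (auto simp: hb subspace_def f.add f.scaleR inner_simps)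
  ultimately have "closure (span (b ` {1..})) \<subseteq> ?T" by (rule closure_minimal[rotated])
  then show ?thesis using h b unfolding S_def orthonormal_basis_def by blast
qed

lemma dual_embed_eqI:
  assumes "\<And>k. l (\<iota> k) = inner h k"
  shows "dual_embed \<iota> l = h"
  unfolding dual_embed_def
proof (rule the_equality)
  fix h' assume "\<forall>k. l (\<iota> k) = inner h' k"
  then have "inner (h' - h) (h' - h) = 0" using assms by (simp add: inner_diff_left)
  then show "h' = h" by simp
qed (simp add: assms)

text \<open>Supplies the existence that the definite description in \<open>dual_embed\<close>
  presupposes; uniqueness is \<open>dual_embed_eqI\<close>.\<close>

lemma dual_embed_inner:
  fixes b :: "nat \<Rightarrow> 'h::{real_inner,complete_space}" and \<iota> :: "'h \<Rightarrow> 'e"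
  assumes "orthonormal_basis b" and "bounded_linear (\<lambda>k. l (\<iota> k))"
  shows "l (\<iota> k) = inner (dual_embed \<iota> l) k"
  using orthonormal_expansion[OF assms] dual_embed_eqI by metis

lemma ennreal_sqrt_le_iff:
  assumes "0 \<le> C"
  shows "ennreal_sqrt T \<le> ennreal C \<longleftrightarrow> T \<le> ennreal (C\<^sup>2)"
proof (cases T)
  case (real t)
  then show ?thesis using assms real_sqrt_le_iff[of t "C\<^sup>2"] by (simp add: ennreal_sqrt_def)
next
  case top
  then show ?thesis by (simp add: ennreal_sqrt_def top_unique)
qed

text \<open>A linear image of a box, built one segment at a time. On a q-bounded set the values of
  \<open>Q n\<close> lie in such a box, which is how finite rank yields compactness.\<close>

lemma compact_sum_box:
  fixes v :: "'k \<Rightarrow> 'e::real_normed_vector"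
  assumes "finite K"
  shows "compact {\<Sum>k\<in>K. c k *\<^sub>R v k | c. \<forall>k\<in>K. \<bar>c k\<bar> \<le> (m k :: real)}" (is "compact (?B K)")
  using assms
proof (induction K rule: finite_induct)
  case empty
  then show ?case by simp
next
  case (insert a K)
  let ?I = "(\<lambda>t. t *\<^sub>R v a) ` {- m a..m a}"
  have "?B (insert a K) = {x + y | x y. x \<in> ?I \<and> y \<in> ?B K}" (is "?L = ?R")
  proof
    show "?L \<subseteq> ?R"
    proof
      fix z assume "z \<in> ?L"
      then obtain c where c: "z = (\<Sum>k\<in>insert a K. c k *\<^sub>R v k)" "\<forall>k\<in>insert a K. \<bar>c k\<bar> \<le> m k" by auto
      then have "z = c a *\<^sub>R v a + (\<Sum>k\<in>K. c k *\<^sub>R v k)" using insert.hyps by simp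
      moreover have "c a *\<^sub>R v a \<in> ?I" using c by (intro imageI) (auto simp: abs_le_iff)
      moreover have "(\<Sum>k\<in>K. c k *\<^sub>R v k) \<in> ?B K" using c by auto
      ultimately show "z \<in> ?R" by blast
    qed
    show "?R \<subseteq> ?L"
    proof
      fix z assume "z \<in> ?R"
      then obtain t c where tc: "t \<in> {- m a..m a}" "\<forall>k\<in>K. \<bar>c k\<bar> \<le> m k" "z = t *\<^sub>R v a + (\<Sum>k\<in>K. c k *\<^sub>R v k)"
        by auto
      have "(\<Sum>k\<in>K. c k *\<^sub>R v k) = (\<Sum>k\<in>K. (c(a := t)) k *\<^sub>R v k)"
        using insert.hyps by (intro sum.cong) auto
      then have "z = (\<Sum>k\<in>insert a K. (c(a := t)) k *\<^sub>R v k)" using tc insert.hyps by simp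
      moreover have "\<forall>k\<in>insert a K. \<bar>(c(a := t)) k\<bar> \<le> m k" using tc by (auto simp: abs_le_iff)
      ultimately show "z \<in> ?L" by blast
    qed
  qed
  moreover have "compact ?R"
    by (intro compact_sums insert.IH compact_continuous_image continuous_intros) simp
  ultimately show ?case by simp
qed

section \<open>The norm of \<open>E_x\<close>\<close>

locale wiener_basis =
  fixes \<iota> :: "'h::{real_inner,complete_space} \<Rightarrow> 'e::banach"
    and \<mu> :: "'e measure"
    and e :: "nat \<Rightarrow> 'e \<Rightarrow>\<^sub>L real" and r :: "nat \<Rightarrow> nat"
  assumes aws: "abstract_wiener_space UNIV norm \<iota> \<mu>"
    and basis: "orthonormal_basis (\<lambda>n. dual_embed \<iota> (e n))"
    and separates: "\<forall>y z. (\<forall>n\<ge>1. e n y = e n z) \<longrightarrow> y = z"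
    and subseq: "strict_mono r"
    and Q_close: "\<forall>n\<ge>1. onorm (\<lambda>h. \<iota> h - Q_tilde \<iota> e r n (\<iota> h)) \<le> (1/2) ^ n"
    and Q_prob: "\<forall>n\<ge>1. measure \<mu> {z. norm (z - Q_tilde \<iota> e r n z) > (1/2) ^ n} \<le> (1/2) ^ n"
begin

abbreviation "b n \<equiv> dual_embed \<iota> (blinfun_apply (e n))"
abbreviation "Q \<equiv> Q_tilde \<iota> e r"
abbreviation "q \<equiv> q_fun \<iota> e r"
abbreviation "E \<equiv> E_sub \<iota> e r"
abbreviation "qn \<equiv> q_norm \<iota> e r"

text \<open>The index at which \<open>Q n\<close> cuts the expansion; the value 0 at n = 0 encodes
  Q_0 = 0 whatever \<open>r 0\<close> is.\<close>

definition s :: "nat \<Rightarrow> nat" where "s n = (if n = 0 then 0 else r n)"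
definition D :: "nat \<Rightarrow> 'e \<Rightarrow> 'e" where "D n z = Q (Suc n) z - Q n z"
text \<open>Series run from 0 and the basis from 1, so \<open>w n\<close> is the weight of
  coordinate \<open>Suc n\<close>.\<close>

definition w :: "nat \<Rightarrow> real" where "w n = 2 powr (- real (Suc n) / 2)"
text \<open>\<open>q\<close> is the supremum of the continuous seminorms \<open>part N\<close>, see \<open>q_eq_SUP\<close>.\<close>

definition part :: "nat \<Rightarrow> 'e \<Rightarrow> real" where
  "part N z = sqrt ((\<Sum>n<N. 2 ^ n * (norm (D n z))\<^sup>2) + (\<Sum>n<N. w n * \<bar>e (Suc n) z\<bar>)\<^sup>2)"

section \<open>Truncation to coordinates and blocks\<close>

lemma bounded_linear_\<iota>: "bounded_linear \<iota>"
proof -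
  obtain C where "linear \<iota>" "\<And>h. norm (\<iota> h) \<le> C * norm h"
    using aws unfolding abstract_wiener_space_def by blast
  then show ?thesis by (intro bounded_linear_intro[of _ C]) (auto simp: linear_add linear_scale mult.commute)
qed

lemma e_\<iota>: "e n (\<iota> h) = inner (b n) h"
  by (rule dual_embed_inner[OF basis])
    (rule bounded_linear_compose[OF blinfun.bounded_linear_right bounded_linear_\<iota>])

lemma inner_b: "j \<ge> 1 \<Longrightarrow> k \<ge> 1 \<Longrightarrow> inner (b j) (b k) = (if j = k then 1 else 0)"
  using basis by (simp add: orthonormal_basis_def)

lemma strict_mono_s: "strict_mono s"
proof (rule strict_mono_onI)
  fix m n :: nat assume "m < n"
  moreover have "n \<le> r n" using subseq by (rule strict_mono_imp_increasing)
  ultimately show "s m < s n" using subseq by (auto simp: s_def strict_mono_def)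
qed

lemma s_mono: "m \<le> n \<Longrightarrow> s m \<le> s n"
  using strict_mono_s by (simp add: strict_mono_less_eq)

lemma s_0 [simp]: "s 0 = 0" by (simp add: s_def)

lemma le_s: "n \<le> s n"
  using strict_mono_s by (rule strict_mono_imp_increasing)

lemma Q_eq: "Q n z = (\<Sum>k\<in>{0<..s n}. e k z *\<^sub>R \<iota> (b k))"
proof -
  have "{1..m} = {0<..m}" for m :: nat by auto
  then show ?thesis by (simp add: Q_tilde_def P_tilde_def s_def)
qed

lemma Q_0 [simp]: "Q 0 z = 0" by (simp add: Q_tilde_def)

lemma D_eq: "D n z = (\<Sum>k\<in>{s n<..s (Suc n)}. e k z *\<^sub>R \<iota> (b k))"
proof -
  have "{0<..s (Suc n)} = {0<..s n} \<union> {s n<..s (Suc n)}" using s_mono[of n "Suc n"] by auto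
  then have "Q (Suc n) z = Q n z + (\<Sum>k\<in>{s n<..s (Suc n)}. e k z *\<^sub>R \<iota> (b k))"
    unfolding Q_eq by (simp only:) (subst sum.union_disjoint; auto)
  then show ?thesis by (simp add: D_def)
qed

text \<open>The functionals \<open>e k\<close> and the vectors \<open>\<iota> (b j)\<close> are
  biorthogonal, so \<open>Q n\<close> erases all coordinates beyond \<open>s n\<close> and keeps the
  others.\<close>

lemma e_Q: "1 \<le> k \<Longrightarrow> e k (Q n z) = (if k \<le> s n then e k z else 0)"
proof -
  assume k: "1 \<le> k"
  have "e k (Q n z) = (\<Sum>j\<in>{0<..s n}. e j z * inner (b k) (b j))"
    by (simp add: Q_eq blinfun.sum_right blinfun.scaleR_right e_\<iota>)
  also have "\<dots> = (\<Sum>j\<in>{0<..s n}. if j = k then e k z else 0)"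
    using k by (intro sum.cong) (auto simp: inner_b)
  finally show ?thesis using k by auto
qed

text \<open>The cut \<open>s n\<close> is a block boundary, so \<open>Q n\<close> keeps or erases
  whole blocks and never splits one.\<close>

lemma D_Q: "D j (Q n z) = (if j < n then D j z else 0)"
proof (cases "j < n")
  case True
  then have "k \<le> s n" if "k \<le> s (Suc j)" for k using s_mono[of "Suc j" n] that by simp
  then show ?thesis using True unfolding D_eq by (auto intro!: sum.cong simp: e_Q)
next
  case False
  then have "\<not> k \<le> s n" if "s j < k" for k using s_mono[of n j] that by simp
  then show ?thesis using False unfolding D_eq by (auto intro!: sum.neutral simp: e_Q)
qed

lemma linear_D: "linear (D n)"
  by (rule linearI) (simp_all add: D_eq blinfun.add_right blinfun.scaleR_right sum.distrib scaleR_add_left scaleR_sum_right)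

lemma continuous_on_D [continuous_intros]: "continuous_on UNIV (D n)"
  unfolding D_eq by (intro continuous_intros)

lemma w_pos: "w n > 0" by (simp add: w_def)

lemma w_sq: "(w n)\<^sup>2 = (1/2) ^ Suc n"
proof -
  have "(w n)\<^sup>2 = 2 powr (- real (Suc n))" by (simp add: w_def power2_eq_square flip: powr_add)
  also have "\<dots> = (1/2) ^ Suc n" by (subst powr_minus, subst powr_realpow) (auto simp: power_one_over inverse_eq_divide)
  finally show ?thesis .
qed

section \<open>The truncated seminorms and their supremum\<close>

lemma part_0 [simp]: "part 0 z = 0" by (simp add: part_def)

lemma part_nonneg: "0 \<le> part N z" by (simp add: part_def sum_nonneg)

text \<open>A single Euclidean norm with N block entries and, in slot N, the whole weighted
  coordinate sum; the triangle inequality thus reduces to Minkowski's.\<close>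

lemma part_L2_set: "part N z = L2_set (\<lambda>n. if n < N then sqrt (2 ^ n) * norm (D n z) else (\<Sum>n<N. w n * \<bar>e (Suc n) z\<bar>)) {..N}"
proof -
  have "{..N} = insert N {..<N}" by auto
  then show ?thesis by (simp add: part_def L2_set_def power_mult_distrib add.commute)
qed

lemma part_scaleR: "part N (c *\<^sub>R z) = \<bar>c\<bar> * part N z"
proof -
  have "(\<Sum>n<N. 2 ^ n * (norm (D n (c *\<^sub>R z)))\<^sup>2) = c\<^sup>2 * (\<Sum>n<N. 2 ^ n * (norm (D n z))\<^sup>2)"
    by (simp add: linear_scale[OF linear_D] sum_distrib_left power_mult_distrib mult_ac)
  moreover have "(\<Sum>n<N. w n * \<bar>e (Suc n) (c *\<^sub>R z)\<bar>) = \<bar>c\<bar> * (\<Sum>n<N. w n * \<bar>e (Suc n) z\<bar>)"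
    by (simp add: blinfun.scaleR_right abs_mult sum_distrib_left mult_ac)
  ultimately have "part N (c *\<^sub>R z) = sqrt (c\<^sup>2 * ((\<Sum>n<N. 2 ^ n * (norm (D n z))\<^sup>2) + (\<Sum>n<N. w n * \<bar>e (Suc n) z\<bar>)\<^sup>2))"
    by (simp add: part_def power_mult_distrib distrib_left)
  then show ?thesis unfolding part_def real_sqrt_mult by simp
qed

lemma part_add: "part N (z + z') \<le> part N z + part N z'"
proof -
  have "w n * \<bar>e (Suc n) z + e (Suc n) z'\<bar> \<le> w n * \<bar>e (Suc n) z\<bar> + w n * \<bar>e (Suc n) z'\<bar>" for n
    using mult_left_mono[OF abs_triangle_ineq less_imp_le[OF w_pos]] by (simp add: distrib_left)
  moreover have "sqrt (2 ^ n) * norm (D n z + D n z') \<le> sqrt (2 ^ n) * norm (D n z) + sqrt (2 ^ n) * norm (D n z')" for n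
    using mult_left_mono[OF norm_triangle_ineq, of "sqrt (2 ^ n)"] by (simp add: distrib_left)
  ultimately have "part N (z + z') \<le> L2_set (\<lambda>n.
      (if n < N then sqrt (2 ^ n) * norm (D n z) else (\<Sum>n<N. w n * \<bar>e (Suc n) z\<bar>)) +
      (if n < N then sqrt (2 ^ n) * norm (D n z') else (\<Sum>n<N. w n * \<bar>e (Suc n) z'\<bar>))) {..N}"
    unfolding part_L2_set
    by (intro L2_set_mono)
      (auto simp: linear_add[OF linear_D] blinfun.add_right less_imp_le[OF w_pos] intro!: sum_nonneg sum_mono simp flip: sum.distrib)
  also have "\<dots> \<le> part N z + part N z'"
    unfolding part_L2_set by (rule L2_set_triangle_ineq)
  finally show ?thesis .
qed

lemma part_uminus: "part N (- z) = part N z"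
  using part_scaleR[of N "-1" z] by simp

lemma continuous_on_part: "continuous_on UNIV (part N)"
  unfolding part_def by (intro continuous_intros)

text \<open>The bridge from the extended-valued \<open>q\<close> to real seminorms: both series have
  nonnegative terms, so the squares of \<open>part N\<close> converge to the square of
  \<open>q\<close> from below. Lower semicontinuity of \<open>q\<close> is used in this
  form.\<close>

lemma q_le_iff:
  assumes C: "0 \<le> C"
  shows "q z \<le> ennreal C \<longleftrightarrow> (\<forall>N. part N z \<le> C)"
proof -
  define f where "f n = 2 ^ n * (norm (D n z))\<^sup>2" for n
  define g where "g n = w n * \<bar>e (Suc n) z\<bar>" for n
  have fg: "0 \<le> f n" "0 \<le> g n" for n by (auto simp: f_def g_def less_imp_le[OF w_pos])
  define T where "T = (\<Sum>n. ennreal (f n)) + (\<Sum>n. ennreal (g n))\<^sup>2"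
  have q: "q z = ennreal_sqrt T"
    by (simp add: q_fun_def T_def f_def g_def D_def w_def)
  have fin: "ennreal ((part N z)\<^sup>2) = (\<Sum>n<N. ennreal (f n)) + (\<Sum>n<N. ennreal (g n))\<^sup>2" for N
    using fg by (simp add: part_def sum_nonneg ennreal_power flip: f_def g_def ennreal_plus)
  have le: "ennreal ((part N z)\<^sup>2) \<le> T" for N
    unfolding fin T_def by (intro add_mono power_mono sum_le_suminf) auto
  have lim: "(\<lambda>N. ennreal ((part N z)\<^sup>2)) \<longlonglongrightarrow> T"
    unfolding fin T_def power2_eq_square[of "(\<Sum>n. ennreal (g n))"] power2_eq_square[of "(\<Sum>n<_. ennreal (g n))"]
    by (intro tendsto_add tendsto_mult_ennreal summable_LIMSEQ) auto
  have iff: "T \<le> ennreal (C\<^sup>2) \<longleftrightarrow> (\<forall>N. ennreal ((part N z)\<^sup>2) \<le> ennreal (C\<^sup>2))"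
    using le LIMSEQ_le_const2[OF lim, of "ennreal (C\<^sup>2)"] by (blast intro: order_trans)
  have "ennreal ((part N z)\<^sup>2) \<le> ennreal (C\<^sup>2) \<longleftrightarrow> part N z \<le> C" for N
    using C part_nonneg[of N z] by (simp add: power_mono_iff)
  then show ?thesis unfolding q ennreal_sqrt_le_iff[OF C] iff by simp
qed

lemma q_eq_SUP: "q z = (SUP N. ennreal (part N z))"
proof (rule antisym)
  show "q z \<le> (SUP N. ennreal (part N z))"
  proof (cases "SUP N. ennreal (part N z)")
    case (real C)
    then have "ennreal (part N z) \<le> ennreal C" for N by (metis SUP_upper UNIV_I)
    then show ?thesis using real by (simp add: q_le_iff)
  next
    case top
    then show ?thesis by (simp only: top_greatest)
  qed
  show "(SUP N. ennreal (part N z)) \<le> q z"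
  proof (cases "q z")
    case (real C)
    then have "\<forall>N. part N z \<le> C" using q_le_iff[of C z] by simp
    then show ?thesis unfolding real by (intro SUP_least ennreal_leI) simp
  next
    case top
    then show ?thesis by (simp only: top_greatest)
  qed
qed

section \<open>The linear space E_x and the seminorm properties of q\<close>

lemma E_I: "(\<And>N. part N z \<le> C) \<Longrightarrow> z \<in> E"
  and qn_le: "(\<And>N. part N z \<le> C) \<Longrightarrow> qn z \<le> C"
proof -
  assume *: "\<And>N. part N z \<le> C"
  \<comment> \<open>The empty truncation N = 0 forces C to be nonnegative.\<close>
  then have "0 \<le> C" using *[of 0] by simp
  then have "q z \<le> ennreal C" using * by (simp add: q_le_iff)
  then show "z \<in> E" "qn z \<le> C" using \<open>0 \<le> C\<close>
    by (auto simp: E_sub_def q_norm_def intro: le_less_trans enn2real_leI)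
qed

lemma q_eq_qn: "z \<in> E \<Longrightarrow> q z = ennreal (qn z)"
  by (simp add: E_sub_def q_norm_def)

lemma qn_nonneg [simp]: "0 \<le> qn z" by (simp add: q_norm_def)

lemma part_le_qn: "z \<in> E \<Longrightarrow> part N z \<le> qn z"
  using q_le_iff[of "qn z" z] q_eq_qn by simp

lemma q_uminus: "q (- z) = q z"
  by (simp add: q_eq_SUP part_uminus)

lemma E_0 [simp]: "0 \<in> E"
  by (rule E_I[of 0 0]) (use part_scaleR[of _ 0 0] in simp)

lemma E_add: "z \<in> E \<Longrightarrow> z' \<in> E \<Longrightarrow> z + z' \<in> E"
  and qn_add: "z \<in> E \<Longrightarrow> z' \<in> E \<Longrightarrow> qn (z + z') \<le> qn z + qn z'"
proof -
  assume "z \<in> E" "z' \<in> E"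
  then have "part N (z + z') \<le> qn z + qn z'" for N
    using part_add[of N z z'] part_le_qn[of z N] part_le_qn[of z' N] by linarith
  then show "z + z' \<in> E" "qn (z + z') \<le> qn z + qn z'" by (blast intro: E_I qn_le)+
qed

lemma E_scaleR: "z \<in> E \<Longrightarrow> c *\<^sub>R z \<in> E"
  and qn_scaleR_le: "z \<in> E \<Longrightarrow> qn (c *\<^sub>R z) \<le> \<bar>c\<bar> * qn z"
proof -
  assume "z \<in> E"
  then have "part N (c *\<^sub>R z) \<le> \<bar>c\<bar> * qn z" for N
    by (simp add: part_scaleR part_le_qn mult_left_mono)
  then show "c *\<^sub>R z \<in> E" "qn (c *\<^sub>R z) \<le> \<bar>c\<bar> * qn z" by (blast intro: E_I qn_le)+
qed

lemma qn_scaleR: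
  assumes "z \<in> E" shows "qn (c *\<^sub>R z) = \<bar>c\<bar> * qn z"
proof (cases "c = 0")
  case True
  then show ?thesis using qn_scaleR_le[OF assms, of 0] qn_nonneg[of "0 *\<^sub>R z"] by (simp del: qn_nonneg)
next
  case False
  have "qn (inverse c *\<^sub>R c *\<^sub>R z) \<le> \<bar>inverse c\<bar> * qn (c *\<^sub>R z)"
    by (intro qn_scaleR_le E_scaleR assms)
  then have "\<bar>c\<bar> * qn z \<le> qn (c *\<^sub>R z)" using False by (simp add: field_simps)
  then show ?thesis using qn_scaleR_le[OF assms, of c] by simp
qed

lemma subspace_E: "subspace E"
  by (simp add: subspace_def E_add E_scaleR)

lemma E_diff: "z \<in> E \<Longrightarrow> z' \<in> E \<Longrightarrow> z - z' \<in> E"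
  using subspace_E by (rule subspace_diff)

text \<open>The factor 2 under the root is the geometric series of 2^(-k) over k \<ge> n divided by
  2^(-n). For n = 0 it becomes the sqrt 2 of (iii).\<close>

lemma norm_Q_diff:
  assumes z: "z \<in> E" and "n \<le> N"
  shows "norm (Q N z - Q n z) \<le> sqrt (2 * (1/2) ^ n) * qn z"
proof -
  have "Q N z - Q n z = (\<Sum>k\<in>{n..<N}. D k z)"
    using sum_Suc_diff'[OF \<open>n \<le> N\<close>, of "\<lambda>k. Q k z"] by (simp add: D_def)
  also have "norm \<dots> \<le> (\<Sum>k\<in>{n..<N}. norm (D k z))" by (rule norm_sum)
  also have "\<dots> = (\<Sum>k\<in>{n..<N}. \<bar>sqrt ((1/2) ^ k)\<bar> * \<bar>sqrt (2 ^ k) * norm (D k z)\<bar>)"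
  proof (rule sum.cong)
    fix k
    have "sqrt ((1/2) ^ k) * sqrt (2 ^ k) = 1" by (simp flip: real_sqrt_mult power_mult_distrib)
    then show "norm (D k z) = \<bar>sqrt ((1/2) ^ k)\<bar> * \<bar>sqrt (2 ^ k) * norm (D k z)\<bar>"
      by (simp add: abs_mult flip: mult.assoc)
  qed simp
  also have "\<dots> \<le> L2_set (\<lambda>k. sqrt ((1/2) ^ k)) {n..<N} * L2_set (\<lambda>k. sqrt (2 ^ k) * norm (D k z)) {n..<N}"
    by (rule L2_set_mult_ineq)
  also have "\<dots> \<le> sqrt (2 * (1/2) ^ n) * qn z"
  proof (rule mult_mono)
    have "(\<Sum>k\<in>{n..<N}. (1/2) ^ k) = 2 * ((1/2) ^ n - (1/2 :: real) ^ N)"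
      using \<open>n \<le> N\<close> by (induction N rule: dec_induct) auto
    then show "L2_set (\<lambda>k. sqrt ((1/2) ^ k)) {n..<N} \<le> sqrt (2 * (1/2) ^ n)"
      by (simp add: L2_set_def)
    have "L2_set (\<lambda>k. sqrt (2 ^ k) * norm (D k z)) {n..<N} \<le> part N z"
    proof -
      have "(\<Sum>k\<in>{n..<N}. 2 ^ k * (norm (D k z))\<^sup>2) \<le> (\<Sum>k<N. 2 ^ k * (norm (D k z))\<^sup>2)"
        by (intro sum_mono2) auto
      then show ?thesis by (simp add: L2_set_def part_def power_mult_distrib add_increasing2)
    qed
    then show "L2_set (\<lambda>k. sqrt (2 ^ k) * norm (D k z)) {n..<N} \<le> qn z"
      using part_le_qn[OF z, of N] by simp
  qed auto
  finally show ?thesis .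
qed

lemma tendsto_sqrt_half_power: "(\<lambda>n. sqrt (2 * (1/2) ^ n) * C) \<longlonglongrightarrow> 0"
  by (auto intro!: tendsto_eq_intros)

text \<open>Finiteness of \<open>q\<close> only makes the sequence Cauchy. Its limit has the same
  coordinates as \<open>z\<close>, and since the coordinates separate points it is
  \<open>z\<close>.\<close>

lemma Q_tendsto:
  assumes z: "z \<in> E" shows "(\<lambda>n. Q n z) \<longlonglongrightarrow> z"
proof -
  have "Cauchy (\<lambda>n. Q n z)"
    unfolding Cauchy_altdef
  proof (intro allI impI)
    fix \<epsilon> :: real assume "\<epsilon> > 0"
    then have "\<forall>\<^sub>F n in sequentially. sqrt (2 * (1/2) ^ n) * qn z < \<epsilon>"
      using order_tendstoD(2)[OF tendsto_sqrt_half_power] by blast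
    then obtain M where "\<And>m. m \<ge> M \<Longrightarrow> sqrt (2 * (1/2) ^ m) * qn z < \<epsilon>" by (auto simp: eventually_sequentially)
    then have "dist (Q m z) (Q n z) < \<epsilon>" if "m \<ge> M" "n > m" for m n
      using that norm_Q_diff[OF z, of m n] by (force simp: dist_norm norm_minus_commute)
    then show "\<exists>M. \<forall>m\<ge>M. \<forall>n>m. dist (Q m z) (Q n z) < \<epsilon>" by blast
  qed
  then obtain y where y: "(\<lambda>n. Q n z) \<longlonglongrightarrow> y" using Cauchy_convergent convergent_def by blast
  have "e k y = e k z" if k: "k \<ge> 1" for k
  proof -
    have "\<forall>\<^sub>F n in sequentially. e k (Q n z) = e k z"
      using eventually_ge_at_top[of k]
    proof eventually_elim
      case (elim n)
      then show ?case using le_s[of n] k by (simp add: e_Q)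
    qed
    then have "(\<lambda>n. e k (Q n z)) \<longlonglongrightarrow> e k z" by (rule tendsto_eventually)
    moreover have "(\<lambda>n. e k (Q n z)) \<longlonglongrightarrow> e k y" by (intro tendsto_intros y)
    ultimately show ?thesis by (rule LIMSEQ_unique[symmetric])
  qed
  then have "y = z" using separates by blast
  then show ?thesis using y by simp
qed

lemma norm_diff_Q:
  assumes z: "z \<in> E" shows "norm (z - Q n z) \<le> sqrt (2 * (1/2) ^ n) * qn z"
proof (rule tendsto_upperbound)
  show "(\<lambda>N. norm (Q N z - Q n z)) \<longlonglongrightarrow> norm (z - Q n z)"
    by (intro tendsto_intros Q_tendsto z)
  show "\<forall>\<^sub>F N in sequentially. norm (Q N z - Q n z) \<le> sqrt (2 * (1/2) ^ n) * qn z"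
    using eventually_ge_at_top[of n] by eventually_elim (rule norm_Q_diff[OF z])
qed simp

lemma norm_le_qn: "z \<in> E \<Longrightarrow> norm z \<le> sqrt 2 * qn z"
  using norm_diff_Q[of z 0] by simp

lemma norm_le_q: "ennreal (norm z) \<le> ennreal (sqrt 2) * q z"
proof (cases "z \<in> E")
  case True
  then show ?thesis using norm_le_qn[OF True] by (simp add: q_eq_qn ennreal_leI flip: ennreal_mult)
next
  case False
  then have "q z = \<infinity>" by (simp add: E_sub_def less_top[symmetric])
  then show ?thesis by (simp add: ennreal_mult_top)
qed

section \<open>Completeness and compactness\<close>

lemma normed_on_E: "normed_on E qn"
  unfolding normed_on_def
proof (intro conjI ballI allI subspace_E qn_nonneg)
  fix v assume "v \<in> E"
  then show "qn v = 0 \<longleftrightarrow> v = 0" using norm_le_qn[of v] qn_scaleR[of 0 0] by auto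
qed (simp_all add: qn_scaleR qn_add)

sublocale E: Metric_space E "\<lambda>v w. qn (v - w)"
proof
  show "qn (x - y) = qn (y - x)" for x y
    using q_uminus[of "x - y"] by (simp add: q_norm_def)
  show "qn (x - y) = 0 \<longleftrightarrow> x = y" if "x \<in> E" "y \<in> E" for x y
    using normed_on_E E_diff[OF that] by (simp add: normed_on_def)
  show "qn (x - z) \<le> qn (x - y) + qn (y - z)" if "x \<in> E" "y \<in> E" "z \<in> E" for x y z
    using qn_add[OF E_diff[of x y] E_diff[of y z]] that by simp
qed simp

lemma banach_on_E: "banach_on E qn"
  unfolding banach_on_def
proof (intro conjI normed_on_E)
  show "E.mcomplete" unfolding E.mcomplete_def
  proof (intro allI impI)
    fix \<sigma> assume C: "E.MCauchy \<sigma>"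
    then have \<sigma>: "\<sigma> n \<in> E" for n by (auto simp: E.MCauchy_def)
    have "Cauchy \<sigma>"
      unfolding Cauchy_altdef
    proof (intro allI impI)
      fix \<epsilon> :: real assume \<epsilon>: "\<epsilon> > 0"
      then obtain M where M: "\<And>m n. M \<le> m \<Longrightarrow> M \<le> n \<Longrightarrow> qn (\<sigma> m - \<sigma> n) < \<epsilon> / sqrt 2"
        using C unfolding E.MCauchy_def by (metis divide_pos_pos real_sqrt_gt_0_iff zero_less_numeral)
      have "dist (\<sigma> m) (\<sigma> n) < \<epsilon>" if "M \<le> m" "m < n" for m n
        using norm_le_qn[OF E_diff[OF \<sigma> \<sigma>], of m n] M[of m n] that by (simp add: dist_norm field_simps)
      then show "\<exists>M. \<forall>m\<ge>M. \<forall>n>m. dist (\<sigma> m) (\<sigma> n) < \<epsilon>" by blast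
    qed
    then obtain z where z: "\<sigma> \<longlonglongrightarrow> z" using Cauchy_convergent convergent_def by blast
    \<comment> \<open>For fixed \<open>N\<close> the passage to the limit needs only continuity of
      \<open>part N\<close> on E, and the bound obtained does not depend on
      \<open>N\<close>.\<close>
    have lsc: "part N (\<sigma> m - z) \<le> \<epsilon>" if "\<And>n. M \<le> n \<Longrightarrow> qn (\<sigma> m - \<sigma> n) < \<epsilon>" for M m N \<epsilon>
    proof (rule tendsto_upperbound)
      have "isCont (part N) (\<sigma> m - z)"
        using continuous_on_part by (simp add: continuous_on_eq_continuous_at)
      then show "(\<lambda>n. part N (\<sigma> m - \<sigma> n)) \<longlonglongrightarrow> part N (\<sigma> m - z)"
        by (rule isCont_tendsto_compose) (intro tendsto_intros z)
      show "\<forall>\<^sub>F n in sequentially. part N (\<sigma> m - \<sigma> n) \<le> \<epsilon>"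
        using eventually_ge_at_top[of M]
      proof eventually_elim
        case (elim n)
        then show ?case using that[of n] part_le_qn[OF E_diff[OF \<sigma> \<sigma>], of N m n] by linarith
      qed
    qed simp
    have Cau: "\<exists>M. \<forall>m\<ge>M. \<forall>n\<ge>M. qn (\<sigma> m - \<sigma> n) < \<epsilon>" if "\<epsilon> > 0" for \<epsilon>
      using C that unfolding E.MCauchy_def by meson
    obtain M where "\<forall>m\<ge>M. \<forall>n\<ge>M. qn (\<sigma> m - \<sigma> n) < 1" using Cau[of 1] by auto
    then have "\<sigma> M - z \<in> E" by (intro E_I[of _ 1] lsc[of M]) auto
    \<comment> \<open>z is the difference of \<open>\<sigma> M\<close> and
      \<open>\<sigma> M - z\<close>, both in E_x.\<close>
    from E_diff[OF \<sigma>[of M] this] have zE: "z \<in> E" by simp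
    have "limitin E.mtopology \<sigma> z sequentially"
      unfolding E.limitin_metric
    proof (intro conjI allI impI zE)
      fix \<epsilon> :: real assume "\<epsilon> > 0"
      \<comment> \<open>Half of \<open>\<epsilon>\<close>, because the limit turns the strict Cauchy
        bound into a weak one.\<close>
      then obtain M where M: "\<forall>m\<ge>M. \<forall>n\<ge>M. qn (\<sigma> m - \<sigma> n) < \<epsilon> / 2" using Cau[of "\<epsilon> / 2"] by auto
      show "\<forall>\<^sub>F n in sequentially. \<sigma> n \<in> E \<and> qn (\<sigma> n - z) < \<epsilon>"
        using eventually_ge_at_top[of M]
      proof eventually_elim
        case (elim n)
        then have "qn (\<sigma> n - z) \<le> \<epsilon> / 2" using M by (intro qn_le lsc[of M]) auto
        then show ?case using \<sigma> \<open>\<epsilon> > 0\<close> by auto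
      qed
    qed
    then show "\<exists>z. limitin E.mtopology \<sigma> z sequentially" ..
  qed
qed

text \<open>\<open>Q n\<close> moves the points of \<open>B\<close> by uniformly little and sends
  them into a compact set, so \<open>B\<close> is totally bounded.\<close>

lemma compact_closure_bounded:
  assumes B: "B \<subseteq> E" "\<And>z. z \<in> B \<Longrightarrow> qn z \<le> C"
  shows "compact (closure B)"
  unfolding compact_eq_totally_bounded
proof (intro conjI allI impI)
  show "Topological_Spaces.complete (closure B)" by (simp add: complete_eq_closed)
  fix \<epsilon> :: real assume \<epsilon>: "\<epsilon> > 0"
  have "\<forall>\<^sub>F n in sequentially. sqrt (2 * (1/2) ^ n) * C < \<epsilon> / 3"
    by (rule order_tendstoD(2)[OF tendsto_sqrt_half_power]) (use \<epsilon> in simp)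
  then obtain n where n: "sqrt (2 * (1/2) ^ n) * C < \<epsilon> / 3"
    using eventually_happens'[OF sequentially_bot] by blast
  \<comment> \<open>The bounds on the coefficients combine \<open>norm z\<close> \<le> sqrt 2 * C
    with the operator norms of the \<open>e k\<close>.\<close>
  define K where "K = {\<Sum>k\<in>{0<..s n}. c k *\<^sub>R \<iota> (b k) | c. \<forall>k\<in>{0<..s n}. \<bar>c k\<bar> \<le> norm (e k) * (sqrt 2 * C)}"
  have "compact K" unfolding K_def by (rule compact_sum_box) simp
  then obtain F where F: "finite F" "K \<subseteq> (\<Union>x\<in>F. ball x (\<epsilon>/3))"
    using \<epsilon> unfolding compact_eq_totally_bounded by (meson divide_pos_pos zero_less_numeral)
  \<comment> \<open>Two thirds of \<open>\<epsilon>\<close> are spent on closed balls, so that the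
    cover passes to the closure; the last third returns to open balls.\<close>
  have "B \<subseteq> (\<Union>x\<in>F. cball x (2 * \<epsilon> / 3))"
  proof
    fix z assume z: "z \<in> B"
    then have zE: "z \<in> E" and zC: "qn z \<le> C" using B by auto
    have "\<bar>e k z\<bar> \<le> norm (e k) * (sqrt 2 * C)" for k
    proof -
      have "norm z \<le> sqrt 2 * C" using norm_le_qn[OF zE] zC by (smt (verit) mult_left_mono real_sqrt_ge_zero)
      then have "norm (e k) * norm z \<le> norm (e k) * (sqrt 2 * C)" by (intro mult_left_mono) auto
      then show ?thesis using norm_blinfun[of "e k" z] by simp
    qed
    then have "Q n z \<in> K" unfolding K_def Q_eq mem_Collect_eq
      by (intro exI[of _ "\<lambda>k. e k z"]) simp
    then obtain x where x: "x \<in> F" "dist x (Q n z) < \<epsilon> / 3" using F by auto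
    have "sqrt (2 * (1/2) ^ n) * qn z \<le> sqrt (2 * (1/2) ^ n) * C"
      using zC by (intro mult_left_mono) auto
    then have "dist (Q n z) z < \<epsilon> / 3"
      using n norm_diff_Q[OF zE, of n] unfolding dist_norm norm_minus_commute[of "Q n z"] by linarith
    then have "dist x z \<le> 2 * \<epsilon> / 3" using x dist_triangle[of x z "Q n z"] by linarith
    then show "z \<in> (\<Union>x\<in>F. cball x (2 * \<epsilon> / 3))" using x by auto
  qed
  moreover have "closed (\<Union>x\<in>F. cball x (2 * \<epsilon> / 3))" using F by (intro closed_UN) auto
  ultimately have "closure B \<subseteq> (\<Union>x\<in>F. cball x (2 * \<epsilon> / 3))" by (rule closure_minimal)
  also have "\<dots> \<subseteq> (\<Union>x\<in>F. ball x \<epsilon>)"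
  proof (intro UN_mono order_refl)
    show "cball x (2 * \<epsilon> / 3) \<subseteq> ball x \<epsilon>" for x :: 'e using \<epsilon> by (auto simp: subset_iff)
  qed
  finally show "\<exists>k. finite k \<and> closure B \<subseteq> (\<Union>x\<in>k. ball x \<epsilon>)" using F by blast
qed

text \<open>By \<open>D_Q\<close> and \<open>e_Q\<close>, subtracting \<open>Q n z\<close> leaves
  the tails of the two series, from n and from \<open>s n\<close>, and both series converge because
  q z is finite.\<close>

lemma qn_diff_Q_tendsto:
  assumes z: "z \<in> E" shows "(\<lambda>n. qn (z - Q n z)) \<longlonglongrightarrow> 0"
proof (rule LIMSEQ_I)
  fix \<epsilon> :: real assume \<epsilon>: "\<epsilon> > 0"
  define f where "f n = 2 ^ n * (norm (D n z))\<^sup>2" for n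
  define g where "g n = w n * \<bar>e (Suc n) z\<bar>" for n
  have fg: "0 \<le> f n" "0 \<le> g n" for n by (auto simp: f_def g_def less_imp_le[OF w_pos])
  have part: "part N z = sqrt ((\<Sum>n<N. f n) + (\<Sum>n<N. g n)\<^sup>2)" for N
    by (simp add: part_def f_def g_def)
  have bnd: "(\<Sum>n<N. f n) + (\<Sum>n<N. g n)\<^sup>2 \<le> (qn z)\<^sup>2" for N
    using part_le_qn[OF z, of N] unfolding part by (rule sqrt_le_D)
  have "summable f"
  proof (rule bounded_imp_summable[of f "(qn z)\<^sup>2"])
    show "(\<Sum>k\<le>n. f k) \<le> (qn z)\<^sup>2" for n
      using bnd[of "Suc n"] by (simp add: lessThan_Suc_atMost) (smt (verit) zero_le_power2)
  qed (rule fg)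
  then obtain N1 where N1: "\<And>m n. m \<ge> N1 \<Longrightarrow> norm (sum f {m..<n}) < (\<epsilon>/3)\<^sup>2"
    using \<epsilon> unfolding summable_Cauchy by (metis divide_pos_pos zero_less_numeral zero_less_power)
  have "summable g"
  proof (rule bounded_imp_summable[of g "qn z"])
    show "(\<Sum>k\<le>n. g k) \<le> qn z" for n
    proof (rule power2_le_imp_le)
      show "(\<Sum>k\<le>n. g k)\<^sup>2 \<le> (qn z)\<^sup>2"
        using bnd[of "Suc n"] sum_nonneg[of "{..<Suc n}" f] fg by (simp add: lessThan_Suc_atMost)
    qed simp
  qed (rule fg)
  then obtain N2 where N2: "\<And>m n. m \<ge> N2 \<Longrightarrow> norm (sum g {m..<n}) < \<epsilon>/3"
    using \<epsilon> unfolding summable_Cauchy by (metis divide_pos_pos zero_less_numeral)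
  have "qn (z - Q n z) \<le> \<epsilon> / 2" if n: "n \<ge> max N1 N2" for n
  proof (rule qn_le)
    fix N
    have "(\<Sum>j<N. 2 ^ j * (norm (D j (z - Q n z)))\<^sup>2) = sum f {n..<N}"
    proof -
      have "(\<Sum>j<N. 2 ^ j * (norm (D j (z - Q n z)))\<^sup>2) = (\<Sum>j<N. if n \<le> j then f j else 0)"
        by (intro sum.cong) (auto simp: linear_diff[OF linear_D] D_Q f_def)
      also have "\<dots> = sum f {n..<N}"
        by (subst sum.inter_filter[symmetric]) (auto intro!: sum.cong)
      finally show ?thesis .
    qed
    moreover have "(\<Sum>j<N. w j * \<bar>e (Suc j) (z - Q n z)\<bar>) = sum g {s n..<N}"
    proof -
      have "(\<Sum>j<N. w j * \<bar>e (Suc j) (z - Q n z)\<bar>) = (\<Sum>j<N. if s n \<le> j then g j else 0)"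
        by (intro sum.cong) (auto simp: blinfun.diff_right e_Q g_def)
      also have "\<dots> = sum g {s n..<N}"
        by (subst sum.inter_filter[symmetric]) (auto intro!: sum.cong)
      finally show ?thesis .
    qed
    ultimately have "part N (z - Q n z) = sqrt (sum f {n..<N} + (sum g {s n..<N})\<^sup>2)"
      by (simp add: part_def)
    also have "\<dots> \<le> sqrt ((\<epsilon>/3)\<^sup>2 + (\<epsilon>/3)\<^sup>2)"
      using N1[of n N] N2[of "s n" N] le_s[of n] n fg
      by (intro real_sqrt_le_mono add_mono power_mono sum_nonneg) auto
    \<comment> \<open>sqrt 2 / 3 < 1/2.\<close>
    also have "\<dots> \<le> \<epsilon> / 2"
      using \<epsilon> by (intro real_le_lsqrt) (auto simp: power2_eq_square field_simps)
    finally show "part N (z - Q n z) \<le> \<epsilon> / 2" .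
  qed
  then show "\<exists>no. \<forall>n\<ge>no. norm (qn (z - Q n z) - 0) < \<epsilon>"
    using \<epsilon> by (intro exI[of _ "max N1 N2"]) (force simp: le_less_trans)
qed

end

section \<open>Gaussian laws and the norm on \<open>H\<close>\<close>

lemma real_distribution_normal_law:
  assumes "0 \<le> s" shows "real_distribution (normal_law m s)"
proof (cases "s = 0")
  case True
  then show ?thesis
    by (auto simp: normal_law_def real_distribution_def real_distribution_axioms_def intro!: prob_space_return)
next
  case False
  then show ?thesis using assms
    by (auto simp: normal_law_def real_distribution_def real_distribution_axioms_def intro!: prob_space_normal_density)
qed

text \<open>One formula covers the point mass and the density, so variances may tend to 0 in the
  limit argument without a case distinction.\<close>

lemma char_normal_law:
  assumes "0 \<le> s" shows "char (normal_law 0 s) t = complex_of_real (exp (- (s * t)\<^sup>2 / 2))"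
proof (cases "s = 0")
  case True
  then show ?thesis by (simp add: normal_law_def char_def integral_return)
next
  case False
  with assms have s: "0 < s" by simp
  interpret N: real_distribution std_normal_distribution by (rule real_dist_normal_dist)
  have "distributed std_normal_distribution lborel (\<lambda>x. x) std_normal_density"
    by (auto simp: distributed_def distr_id2)
  from N.normal_density_affine[OF this, of s 0]
  have "distr std_normal_distribution lborel (\<lambda>x. s * x) = normal_law 0 s"
    using s by (simp add: distributed_def normal_law_def)
  then have "char (normal_law 0 s) t = (CLINT x|distr std_normal_distribution lborel (\<lambda>x. s * x). iexp (t * x))"
    by (simp add: char_def)
  also have "\<dots> = (CLINT x|std_normal_distribution. iexp (t * (s * x)))"
    by (subst integral_distr) auto
  also have "\<dots> = char std_normal_distribution (s * t)"
    by (simp add: char_def mult_ac)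
  finally show ?thesis by (simp add: char_std_normal_distribution)
qed

context wiener_basis
begin

section \<open>Measurability and laws of functionals under mu\<close>

lemma sets_\<mu>: "sets \<mu> = sets borel"
proof -
  have "(\<lambda>v w. norm (v - w)) = (dist :: 'e \<Rightarrow> 'e \<Rightarrow> real)" by (intro ext) (simp add: dist_norm)
  note * = aws[unfolded abstract_wiener_space_def this mtopology_is_euclidean]
  then have "sets \<mu> = sigma_sets UNIV {U. openin euclidean U}" by blast
  then show ?thesis by (simp add: borel_def flip: open_openin)
qed

lemma space_\<mu> [simp]: "space \<mu> = UNIV"
  and prob_space_\<mu>: "prob_space \<mu>"
  and separable_H: "separable_space (euclidean :: 'h topology)"
  and inj_\<iota>: "inj \<iota>"
  using aws unfolding abstract_wiener_space_def by blast+

lemma distr_\<mu>: "l \<in> dual_on UNIV norm \<Longrightarrow> distr \<mu> borel l = normal_law 0 (norm (dual_embed \<iota> l))"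
  using aws unfolding abstract_wiener_space_def by blast

sublocale \<mu>: prob_space \<mu> by (rule prob_space_\<mu>)

lemma continuous_measurable: "continuous_on UNIV f \<Longrightarrow> f \<in> borel_measurable \<mu>"
  using borel_measurable_continuous_onI sets_\<mu> measurable_cong_sets by blast

lemma measurable_blinfun [measurable]: "blinfun_apply L \<in> borel_measurable \<mu>"
  by (intro continuous_measurable continuous_intros)

lemma measurable_part [measurable]: "part N \<in> borel_measurable \<mu>"
  by (intro continuous_measurable continuous_on_part)

lemma measurable_q [measurable]: "q \<in> borel_measurable \<mu>"
  unfolding q_eq_SUP[abs_def] by measurable

lemma sets_E [measurable]: "E \<in> sets \<mu>"
proof -
  have "E = {z \<in> space \<mu>. q z < \<infinity>}" by (simp add: E_sub_def)
  also have "\<dots> \<in> sets \<mu>" by measurable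
  finally show ?thesis .
qed

lemma distr_blinfun: "distr \<mu> borel (blinfun_apply L) = normal_law 0 (norm (dual_embed \<iota> L))"
proof (rule distr_\<mu>)
  show "blinfun_apply L \<in> dual_on UNIV norm"
    using norm_blinfun[of L] by (auto simp: dual_on_def blinfun.add_right blinfun.scaleR_right)
qed

lemma blinfun_\<iota>: "blinfun_apply L (\<iota> h) = inner (dual_embed \<iota> L) h"
  by (rule dual_embed_inner[OF basis])
    (rule bounded_linear_compose[OF blinfun.bounded_linear_right bounded_linear_\<iota>])

lemma char_blinfun:
  fixes L :: "'e \<Rightarrow>\<^sub>L real"
  shows "(CLINT z|\<mu>. iexp (t * L z)) = complex_of_real (exp (- (norm (dual_embed \<iota> L) * t)\<^sup>2 / 2))"
proof -
  have "(CLINT z|\<mu>. iexp (t * L z)) = char (distr \<mu> borel (blinfun_apply L)) t"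
    unfolding char_def by (subst integral_distr) auto
  then show ?thesis by (simp add: distr_blinfun char_normal_law)
qed

section \<open>Full measure of E_x\<close>

lemma nn_integral_abs_e:
  assumes "n \<ge> 1"
  shows "(\<integral>\<^sup>+z. ennreal \<bar>e n z\<bar> \<partial>\<mu>) = (\<integral>\<^sup>+x. ennreal \<bar>x\<bar> \<partial>normal_law 0 1)"
proof -
  have "inner (b n) (b n) = 1" using inner_b[OF assms assms] by simp
  then have "norm (b n) = 1" by (simp add: norm_eq_sqrt_inner)
  then show ?thesis
    unfolding distr_blinfun[of "e n", unfolded \<open>norm (b n) = 1\<close>, symmetric] by (subst nn_integral_distr) auto
qed

lemma nn_integral_abs_normal_law: "(\<integral>\<^sup>+x. ennreal \<bar>x\<bar> \<partial>normal_law 0 1) < \<infinity>"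
  using integrable_std_normal_distribution_moment[of 1]
  by (simp add: integrable_iff_bounded normal_law_def)

lemma summable_w: "summable w"
proof -
  have "w n = (sqrt (1/2)) ^ Suc n" for n
    using w_sq[of n] less_imp_le[OF w_pos[of n]] by (metis real_sqrt_power real_sqrt_unique)
  then have "w = (\<lambda>n. sqrt (1/2) * sqrt (1/2) ^ n)" by auto
  moreover have "summable (\<lambda>n. sqrt (1/2) * sqrt (1/2) ^ n)"
    by (intro summable_mult summable_geometric) (simp add: real_sqrt_divide)
  ultimately show ?thesis by simp
qed

lemma AE_E: "AE z in \<mu>. z \<in> E"
proof -
  have [measurable]: "(\<lambda>z. norm (z - Q n z)) \<in> borel_measurable \<mu>" for n
    unfolding Q_eq by (intro continuous_measurable continuous_intros)
  have "AE z in \<mu>. eventually (\<lambda>n. z \<in> space \<mu> - {z \<in> space \<mu>. norm (z - Q n z) > (1/2) ^ n}) sequentially"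
  proof (rule borel_cantelli_AE1)
    \<comment> \<open>\<open>Q_prob\<close> starts at n = 1; at n = 0 the bound is 1 and holds for
      any probability.\<close>
    have "\<mu>.prob {z \<in> space \<mu>. norm (z - Q n z) > (1/2) ^ n} \<le> (1/2) ^ n" for n
      using Q_prob \<mu>.prob_le_1[of "{z. norm z > 1}"] by (cases "n = 0") (auto simp: Q_0)
    then show "summable (\<lambda>n. \<mu>.prob {z \<in> space \<mu>. norm (z - Q n z) > (1/2) ^ n})"
      by (intro summable_comparison_test'[OF summable_geometric[of "1/2"]]) auto
    show "{z \<in> space \<mu>. norm (z - Q n z) > (1/2) ^ n} \<in> sets \<mu>" for n by measurable
  qed (simp add: \<mu>.emeasure_eq_measure)
  \<comment> \<open>The coordinate series has expectation c times the sum of the weights, which is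
    finite.\<close>
  moreover have "AE z in \<mu>. (\<Sum>n. ennreal (w n * \<bar>e (Suc n) z\<bar>)) \<noteq> \<infinity>"
  proof (rule nn_integral_PInf_AE)
    obtain c where c: "(\<integral>\<^sup>+x. ennreal \<bar>x\<bar> \<partial>normal_law 0 1) = ennreal c" "0 \<le> c"
      using nn_integral_abs_normal_law by (cases "\<integral>\<^sup>+x. ennreal \<bar>x\<bar> \<partial>normal_law 0 1") auto
    have "(\<integral>\<^sup>+z. (\<Sum>n. ennreal (w n * \<bar>e (Suc n) z\<bar>)) \<partial>\<mu>) = (\<Sum>n. ennreal (w n) * (\<integral>\<^sup>+z. ennreal \<bar>e (Suc n) z\<bar> \<partial>\<mu>))"
      by (simp add: nn_integral_suminf nn_integral_cmult ennreal_mult less_imp_le[OF w_pos])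
    also have "\<dots> = (\<Sum>n. ennreal (w n * c))"
      using c by (simp add: nn_integral_abs_e ennreal_mult less_imp_le[OF w_pos])
    also have "\<dots> \<noteq> \<infinity>"
      using c less_imp_le[OF w_pos] summable_mult2[OF summable_w, of c] by (subst suminf_ennreal2) auto
    finally show "(\<integral>\<^sup>+z. (\<Sum>n. ennreal (w n * \<bar>e (Suc n) z\<bar>)) \<partial>\<mu>) \<noteq> \<infinity>" .
  qed measurable
  ultimately show ?thesis
  proof eventually_elim
    case (elim z)
    define f where "f n = 2 ^ n * (norm (D n z))\<^sup>2" for n
    define g where "g n = w n * \<bar>e (Suc n) z\<bar>" for n
    have fg: "0 \<le> f n" "0 \<le> g n" for n by (auto simp: f_def g_def less_imp_le[OF w_pos])
    from elim(1) obtain M where M: "\<And>n. n \<ge> M \<Longrightarrow> norm (z - Q n z) \<le> (1/2) ^ n"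
      by (auto simp: eventually_sequentially not_less)
    \<comment> \<open>The block is the difference of two errors of size at most 2^(-n), and 2^n (2 *
      2^(-n))^2 = 4 * 2^(-n).\<close>
    have "f n \<le> 4 * (1/2) ^ n" if "n \<ge> M" for n
    proof -
      have "D n z = (z - Q n z) - (z - Q (Suc n) z)" by (simp add: D_def)
      then have "norm (D n z) \<le> norm (z - Q n z) + norm (z - Q (Suc n) z)" by (simp only: norm_triangle_ineq4)
      also have "\<dots> \<le> (1/2) ^ n + (1/2) ^ Suc n" using M[of n] M[of "Suc n"] that by simp
      also have "\<dots> \<le> 2 * (1/2) ^ n" by simp
      finally have "(norm (D n z))\<^sup>2 \<le> (2 * (1/2) ^ n)\<^sup>2" by (intro power_mono) auto
      then have "f n \<le> 2 ^ n * (2 * (1/2) ^ n)\<^sup>2" unfolding f_def by (intro mult_left_mono) auto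
      also have "\<dots> = 4 * (2 ^ n * (1/2) ^ n) * (1/2) ^ n" by (simp add: power2_eq_square)
      also have "2 ^ n * (1/2 :: real) ^ n = 1" by (simp flip: power_mult_distrib)
      finally show ?thesis by simp
    qed
    then have sf: "summable f"
      using fg by (intro summable_comparison_test'[OF summable_mult[OF summable_geometric[of "1/2"], of 4], of M]) auto
    have sg: "summable g"
      using elim(2) fg by (intro summable_suminf_not_top) (auto simp: g_def)
    show "z \<in> E"
    proof (rule E_I)
      fix N
      show "part N z \<le> sqrt (suminf f + (suminf g)\<^sup>2)"
        unfolding part_def f_def[symmetric] g_def[symmetric]
        using fg sf sg by (intro real_sqrt_le_mono add_mono power_mono sum_le_suminf sum_nonneg) auto
    qed
  qed
qed

lemma emeasure_E: "emeasure \<mu> E = 1"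
  using \<mu>.emeasure_eq_1_AE[OF sets_E AE_E] .

text \<open>Under the root stand K^2 |h|^2 from the blocks and at most K^2 |h|^2 from the coordinate
  sum, hence sqrt 2. \<open>K\<close> dominates 1 and the norm of \<open>\<iota>\<close>, so that
  one block estimate serves n = 0, where only that norm is available, and n \<ge> 1.\<close>

lemma part_\<iota>_le: "part N (\<iota> h) \<le> sqrt 2 * max 1 (onorm \<iota>) * norm h"
proof -
  define K where "K = max 1 (onorm \<iota>)"
  define a where "a k = inner (b k) h" for k
  define p where "p I = (\<Sum>k\<in>I. a k *\<^sub>R b k)" for I
  have norm_p: "(norm (p I))\<^sup>2 = (\<Sum>k\<in>I. (a k)\<^sup>2)" if "finite I" "0 \<notin> I" for I
    unfolding p_def by (rule norm_sum_orthonormal[OF basis that])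
  have bessel: "(\<Sum>k\<in>I. (a k)\<^sup>2) \<le> (norm h)\<^sup>2" if I: "finite I" "0 \<notin> I" for I
  proof -
    have "inner (p I) h = (\<Sum>k\<in>I. (a k)\<^sup>2)"
      by (simp add: p_def a_def inner_sum_left power2_eq_square)
    then have "(norm (h - p I))\<^sup>2 = (norm h)\<^sup>2 - (\<Sum>k\<in>I. (a k)\<^sup>2)"
      using norm_p[OF I] by (simp add: power2_norm_eq_inner inner_diff_left inner_diff_right inner_commute)
    then show ?thesis using zero_le_power2[of "norm (h - p I)"] by linarith
  qed
  have K: "K \<ge> 1" "K \<ge> 0" by (auto simp: K_def)
  have close: "norm (D n (\<iota> h)) \<le> (1/2) ^ n * K * norm (p {s n<..s (Suc n)})" for n
  proof -
    let ?u = "p {s n<..s (Suc n)}"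
    have Du: "D n (\<iota> h) = \<iota> ?u"
      unfolding D_eq p_def a_def
      by (simp add: e_\<iota> linear_sum[OF bounded_linear.linear[OF bounded_linear_\<iota>]] linear_scale[OF bounded_linear.linear[OF bounded_linear_\<iota>]])
    show ?thesis
    proof (cases "n = 0")
      case True
      have "norm (\<iota> ?u) \<le> onorm \<iota> * norm ?u" by (rule onorm[OF bounded_linear_\<iota>])
      also have "\<dots> \<le> K * norm ?u" by (intro mult_right_mono) (auto simp: K_def)
      finally show ?thesis using Du True by simp
    next
      case False
      \<comment> \<open>The block starts after \<open>s n\<close>, so \<open>Q n\<close> annihilates
        it and closeness of \<open>Q n\<close> to the identity bounds the block itself.\<close>
      have "e k (D n (\<iota> h)) = 0" if "k \<in> {0<..s n}" for k
        using that s_mono[of n "Suc n"] by (simp add: D_def blinfun.diff_right e_Q)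
      then have "Q n (D n (\<iota> h)) = 0" by (simp add: Q_eq[of n "D n (\<iota> h)"])
      then have "D n (\<iota> h) = \<iota> ?u - Q n (\<iota> ?u)" by (simp add: Du)
      also have "norm \<dots> \<le> onorm (\<lambda>h. \<iota> h - Q n (\<iota> h)) * norm ?u"
      proof (rule onorm)
        show "bounded_linear (\<lambda>h. \<iota> h - Q n (\<iota> h))"
          unfolding Q_eq e_\<iota>
          by (intro bounded_linear_sub bounded_linear_\<iota> bounded_linear_sum bounded_linear_scaleR_left[THEN bounded_linear_compose] bounded_linear_inner_right)
      qed
      also have "\<dots> \<le> (1/2) ^ n * norm ?u" using Q_close False by (intro mult_right_mono) auto
      also have "\<dots> \<le> (1/2) ^ n * K * norm ?u" using K by (intro mult_right_mono) auto
      finally show ?thesis .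
    qed
  qed
  \<comment> \<open>What remains of 2^n * 4^(-n) is at most 1; no decay is kept, because Bessel's
    inequality already sums the blocks.\<close>
  have "2 ^ n * (norm (D n (\<iota> h)))\<^sup>2 \<le> K\<^sup>2 * (\<Sum>k\<in>{s n<..s (Suc n)}. (a k)\<^sup>2)" for n
  proof -
    have "2 ^ n * (norm (D n (\<iota> h)))\<^sup>2 \<le> 2 ^ n * ((1/2) ^ n * K * norm (p {s n<..s (Suc n)}))\<^sup>2"
      using close[of n] by (intro mult_left_mono power_mono) auto
    also have "\<dots> = (2 ^ n * (1/2) ^ n) * (1/2) ^ n * (K\<^sup>2 * (norm (p {s n<..s (Suc n)}))\<^sup>2)"
      by (simp add: power2_eq_square mult_ac)
    also have "2 ^ n * (1/2 :: real) ^ n = 1" by (simp flip: power_mult_distrib)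
    also have "1 * (1/2) ^ n * (K\<^sup>2 * (norm (p {s n<..s (Suc n)}))\<^sup>2) \<le> 1 * (K\<^sup>2 * (norm (p {s n<..s (Suc n)}))\<^sup>2)"
      by (intro mult_right_mono) (auto simp: power_le_one)
    finally show ?thesis by (simp add: norm_p)
  qed
  then have "(\<Sum>n<N. 2 ^ n * (norm (D n (\<iota> h)))\<^sup>2) \<le> (\<Sum>n<N. K\<^sup>2 * (\<Sum>k\<in>{s n<..s (Suc n)}. (a k)\<^sup>2))"
    by (rule sum_mono)
  also have "\<dots> = K\<^sup>2 * (\<Sum>k\<in>{0<..s N}. (a k)\<^sup>2)"
  proof -
    have "(\<Sum>n<N. (\<Sum>k\<in>{s n<..s (Suc n)}. (a k)\<^sup>2)) = (\<Sum>k\<in>{0<..s N}. (a k)\<^sup>2)" for N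
    proof (induction N)
      case (Suc N)
      have "{0<..s (Suc N)} = {0<..s N} \<union> {s N<..s (Suc N)}" using s_mono[of N "Suc N"] by auto
      then show ?case using Suc by (simp only: sum.lessThan_Suc) (subst sum.union_disjoint; auto)
    qed simp
    then show ?thesis by (simp flip: sum_distrib_left)
  qed
  also have "\<dots> \<le> K\<^sup>2 * (norm h)\<^sup>2" by (intro mult_left_mono bessel) auto
  finally have 1: "(\<Sum>n<N. 2 ^ n * (norm (D n (\<iota> h)))\<^sup>2) \<le> K\<^sup>2 * (norm h)\<^sup>2" .
  have "(\<Sum>n<N. w n * \<bar>e (Suc n) (\<iota> h)\<bar>) = (\<Sum>n<N. \<bar>w n\<bar> * \<bar>a (Suc n)\<bar>)"
    using w_pos by (simp add: e_\<iota> a_def less_imp_le)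
  also have "\<dots> \<le> L2_set w {..<N} * L2_set (\<lambda>n. a (Suc n)) {..<N}" by (rule L2_set_mult_ineq)
  also have "\<dots> \<le> 1 * norm h"
  proof (rule mult_mono)
    \<comment> \<open>The squared weights 1/2, 1/4, ... sum to less than 1, so Cauchy-Schwarz costs
      no constant.\<close>
    have "(\<Sum>n<N. (w n)\<^sup>2) = 1 - (1/2) ^ N" unfolding w_sq by (induction N) auto
    then show "L2_set w {..<N} \<le> 1" by (simp add: L2_set_def)
    have "(\<Sum>n<N. (a (Suc n))\<^sup>2) = (\<Sum>k\<in>Suc ` {..<N}. (a k)\<^sup>2)" by (subst sum.reindex) auto
    then have "(\<Sum>n<N. (a (Suc n))\<^sup>2) \<le> (norm h)\<^sup>2" using bessel[of "Suc ` {..<N}"] by auto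
    then show "L2_set (\<lambda>n. a (Suc n)) {..<N} \<le> norm h" unfolding L2_set_def by (rule real_le_lsqrt[rotated]) simp
  qed auto
  finally have "(\<Sum>n<N. w n * \<bar>e (Suc n) (\<iota> h)\<bar>)\<^sup>2 \<le> (norm h)\<^sup>2"
    by (intro power_mono) (auto intro!: sum_nonneg simp: less_imp_le[OF w_pos])
  also have "\<dots> \<le> K\<^sup>2 * (norm h)\<^sup>2" using K by (simp add: mult_le_cancel_right1)
  finally have "part N (\<iota> h) \<le> sqrt (2 * (K * norm h)\<^sup>2)"
    unfolding part_def using 1 by (intro real_sqrt_le_mono) (simp add: power_mult_distrib)
  then show ?thesis using K unfolding real_sqrt_mult by (simp add: K_def)
qed

lemma \<iota>_in_E: "\<iota> h \<in> E"
  by (rule E_I[OF part_\<iota>_le])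

lemma qn_\<iota>_le: "qn (\<iota> h) \<le> sqrt 2 * max 1 (onorm \<iota>) * norm h"
  by (rule qn_le[OF part_\<iota>_le])

text \<open>The estimate with sqrt 2, relaxed to the constant of (ii).\<close>

lemma q_\<iota>_le: "q (\<iota> h) \<le> ennreal (sqrt 3 * max 1 (onorm \<iota>) * norm h)"
proof -
  have "sqrt 2 * max 1 (onorm \<iota>) * norm h \<le> sqrt 3 * max 1 (onorm \<iota>) * norm h"
    by (intro mult_right_mono) auto
  then show ?thesis using qn_\<iota>_le[of h] unfolding q_eq_qn[OF \<iota>_in_E] by (intro ennreal_leI) simp
qed

lemma q_\<iota>_le_contraction:
  assumes "\<And>h. norm (\<iota> h) \<le> norm h"
  shows "q (\<iota> h) \<le> ennreal (sqrt 3 * norm h)"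
proof -
  have "onorm \<iota> \<le> 1" by (rule onorm_bound) (use assms in simp_all)
  then show ?thesis using q_\<iota>_le[of h] by (simp add: max_absorb1)
qed

end

section \<open>The Wiener measure on \<open>E_x\<close>\<close>

context wiener_basis
begin

lemma Q_in_range: "Q n z \<in> range \<iota>"
proof -
  have "Q n z = \<iota> (\<Sum>k\<in>{0<..s n}. e k z *\<^sub>R b k)"
    by (simp add: Q_eq linear_sum[OF bounded_linear.linear[OF bounded_linear_\<iota>]] linear_scale[OF bounded_linear.linear[OF bounded_linear_\<iota>]])
  then show ?thesis by blast
qed

text \<open>Density for the stronger norm: \<open>Q n z\<close> lies in H and tends to
  \<open>z\<close> for \<open>q\<close>.\<close>

lemma range_\<iota>_dense_E: "E.mtopology closure_of range \<iota> = E"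
proof -
  have "\<exists>y\<in>range \<iota>. y \<in> E.mball z \<delta>" if z: "z \<in> E" and "\<delta> > 0" for z \<delta>
  proof -
    have "\<forall>\<^sub>F n in sequentially. qn (z - Q n z) < \<delta>"
      using order_tendstoD(2)[OF qn_diff_Q_tendsto[OF z] \<open>\<delta> > 0\<close>] .
    then obtain n where "qn (z - Q n z) < \<delta>" using eventually_happens'[OF sequentially_bot] by blast
    then show ?thesis using Q_in_range[of n z] \<iota>_in_E z by (intro bexI[of _ "Q n z"]) auto
  qed
  then show ?thesis unfolding E.metric_closure_of by blast
qed

text \<open>Traces of open sets of E are open for \<open>q\<close> since \<open>q\<close> dominates
  the norm up to sqrt 2. Conversely, q-balls are Borel in E as \<open>q\<close> is a supremum of
  continuous seminorms, and a q-open set is a countable union of balls with rational radii centred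
  in a countable dense subset of H.\<close>

lemma sets_restrict_E: "sets (restrict_space \<mu> E) = sigma_sets E {U. openin E.mtopology U}"
proof -
  interpret R: sigma_algebra E "sets (restrict_space \<mu> E)"
    using sets.sigma_algebra_axioms[of "restrict_space \<mu> E"] by (simp add: space_restrict_space)
  have gen: "sets \<mu> = sigma_sets UNIV {U. open U}"
    unfolding sets_\<mu> borel_def by simp
  have eq: "sets (restrict_space \<mu> E) = sigma_sets E ((\<inter>) E ` {U. open U})"
    unfolding sets_restrict_space gen
    by (rule sigma_sets_Int[OF sets_E[unfolded gen] subset_UNIV])
  have "sigma_sets E ((\<inter>) E ` {U. open U}) \<subseteq> sigma_sets E {U. openin E.mtopology U}"
  proof (rule sigma_sets_mono, safe intro!: sigma_sets.Basic)
    fix U :: "'e set" assume U: "open U"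
    show "openin E.mtopology (E \<inter> U)"
      unfolding E.openin_mtopology
    proof (intro conjI allI impI)
      fix z assume z: "z \<in> E \<inter> U"
      then obtain \<delta> where \<delta>: "\<delta> > 0" "\<And>y. dist y z < \<delta> \<Longrightarrow> y \<in> U" using U open_dist by blast
      have "E.mball z (\<delta> / sqrt 2) \<subseteq> E \<inter> U"
      proof
        fix y assume y: "y \<in> E.mball z (\<delta> / sqrt 2)"
        then have "norm (z - y) \<le> sqrt 2 * qn (z - y)" by (intro norm_le_qn E_diff) auto
        also have "\<dots> < \<delta>" using y by (simp add: field_simps)
        finally show "y \<in> E \<inter> U" using y \<delta>(2)[of y] by (simp add: dist_norm norm_minus_commute)
      qed
      then show "\<exists>r>0. E.mball z r \<subseteq> E \<inter> U" using \<delta>(1) by (intro exI[of _ "\<delta> / sqrt 2"]) simp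
    qed auto
  qed
  moreover have "U \<in> sets (restrict_space \<mu> E)" if U: "openin E.mtopology U" for U
  proof -
    obtain S :: "'h set" where S: "countable S" "closure S = UNIV"
      using separable_H unfolding separable_space_def by (auto simp: euclidean_closure_of)
    have ball: "E.mball c \<rho> \<in> sets (restrict_space \<mu> E)" if c: "c \<in> E" for c \<rho>
    proof -
      have "(\<lambda>z. part N (c - z)) \<in> borel_measurable \<mu>" for N
        by (intro continuous_measurable continuous_on_compose2[OF continuous_on_part] continuous_intros) auto
      then have [measurable]: "(\<lambda>z. q (c - z)) \<in> borel_measurable \<mu>"
        unfolding q_eq_SUP by measurable
      have "E.mball c \<rho> = E \<inter> {z \<in> space \<mu>. q (c - z) < ennreal \<rho>}"
        using c E_diff[OF c] by (auto simp: q_eq_qn ennreal_less_iff)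
      also have "\<dots> \<in> sets (restrict_space \<mu> E)"
        unfolding sets_restrict_space by (intro imageI) measurable
      finally show ?thesis .
    qed
    define F where "F = {E.mball (\<iota> c) \<rho> | c \<rho>. c \<in> S \<and> \<rho> \<in> \<rat> \<and> E.mball (\<iota> c) \<rho> \<subseteq> U}"
    have "F \<subseteq> (\<lambda>(c, \<rho>). E.mball (\<iota> c) \<rho>) ` (S \<times> \<rat>)" unfolding F_def by auto
    then have "countable F" using S(1) countable_rat by (meson countable_SIGMA countable_image countable_subset)
    moreover have "F \<subseteq> sets (restrict_space \<mu> E)" unfolding F_def using ball \<iota>_in_E by auto
    moreover have "U = \<Union>F"
    proof
      show "\<Union>F \<subseteq> U" unfolding F_def by auto
      show "U \<subseteq> \<Union>F"
      proof
        fix z assume zU: "z \<in> U"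
        then obtain \<delta> where \<delta>: "\<delta> > 0" "E.mball z \<delta> \<subseteq> U" and z: "z \<in> E"
          using U unfolding E.openin_mtopology by blast
        \<comment> \<open>Below \<open>\<delta>\<close>/2, because a ball of radius
          \<open>\<rho>\<close> whose centre is within \<open>\<rho>\<close> of \<open>z\<close>
          must fit into the \<open>\<delta>\<close>-ball around \<open>z\<close>.\<close>
        obtain \<rho> where \<rho>: "\<rho> \<in> \<rat>" "0 < \<rho>" "\<rho> < \<delta> / 2" using Rats_dense_in_real[of 0 "\<delta> / 2"] \<delta>(1) by auto
        have "z \<in> E.mtopology closure_of range \<iota>" using z range_\<iota>_dense_E by simp
        then obtain h where h: "qn (z - \<iota> h) < \<rho> / 2"
          unfolding E.metric_closure_of using \<rho>(2) half_gt_zero[OF \<rho>(2)] by fastforce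
        \<comment> \<open>\<open>K\<close> converts distances in H into q-distances:
          \<open>\<iota> h\<close> is q-close to \<open>z\<close>, and then \<open>c\<close> is
          chosen close to \<open>h\<close> in H.\<close>
        define K where "K = sqrt 2 * max 1 (onorm \<iota>)"
        have K: "K > 0" unfolding K_def by (simp add: less_max_iff_disj)
        have "h \<in> closure S" using S(2) by simp
        then obtain c where c: "c \<in> S" "dist c h < \<rho> / 2 / K"
          unfolding closure_approachable using \<rho>(2) K by (meson divide_pos_pos half_gt_zero)
        have lin: "\<iota> h - \<iota> c = \<iota> (h - c)"
          using linear_diff[OF bounded_linear.linear[OF bounded_linear_\<iota>]] by simp
        have "qn (\<iota> h - \<iota> c) \<le> K * norm (h - c)" unfolding lin K_def by (rule qn_\<iota>_le)
        also have "\<dots> < \<rho> / 2" using c(2) K by (simp add: dist_norm norm_minus_commute field_simps)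
        finally have *: "qn (z - \<iota> c) < \<rho>"
          using h qn_add[OF E_diff[OF z \<iota>_in_E[of h]] E_diff[OF \<iota>_in_E[of h] \<iota>_in_E[of c]]] by simp
        have "E.mball (\<iota> c) \<rho> \<subseteq> E.mball z \<delta>"
          using * \<rho>(3) z \<iota>_in_E[of c] by (intro E.mball_subset) (auto simp: E.commute[of "\<iota> c" z])
        then have "E.mball (\<iota> c) \<rho> \<in> F" unfolding F_def using c(1) \<rho>(1) \<delta>(2) by blast
        moreover have "z \<in> E.mball (\<iota> c) \<rho>" using * z \<iota>_in_E by (simp add: E.commute[of "\<iota> c" z])
        ultimately show "z \<in> \<Union>F" by blast
      qed
    qed
    ultimately show ?thesis by (simp add: R.countable_Union)
  qed
  then have "sigma_sets E {U. openin E.mtopology U} \<subseteq> sets (restrict_space \<mu> E)"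
    by (intro R.sigma_sets_subset) auto
  ultimately show ?thesis unfolding eq by (rule subset_antisym)
qed

lemma prob_space_restrict_E: "prob_space (restrict_space \<mu> E)"
  by (rule prob_space_restrict_space) (auto simp: sets_E emeasure_E)

text \<open>A functional bounded for \<open>q\<close> need not be continuous on E, so the hypothesis
  on mu says nothing about its law directly; it is reached through functionals in E'.\<close>

lemma distr_restrict_E:
  assumes l: "l \<in> dual_on E qn"
  shows "distr (restrict_space \<mu> E) borel l = normal_law 0 (norm (dual_embed \<iota> l))"
proof -
  let ?R = "restrict_space \<mu> E"
  interpret R: prob_space ?R by (rule prob_space_restrict_E)
  obtain C where C: "\<And>v. v \<in> E \<Longrightarrow> \<bar>l v\<bar> \<le> C * qn v"
    and add: "\<And>v w. v \<in> E \<Longrightarrow> w \<in> E \<Longrightarrow> l (v + w) = l v + l w"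
    and scale: "\<And>v c. v \<in> E \<Longrightarrow> l (c *\<^sub>R v) = c * l v"
    using l unfolding dual_on_def by blast
  have lin: "\<iota> (x + y) = \<iota> x + \<iota> y" "\<iota> (c *\<^sub>R x) = c *\<^sub>R \<iota> x" for x y c
    using bounded_linear_\<iota> by (simp_all add: linear_add linear_scale bounded_linear.linear)
  have bl: "bounded_linear (\<lambda>k. l (\<iota> k))"
  proof (rule bounded_linear_intro)
    fix k
    have "\<bar>l (\<iota> k)\<bar> \<le> C * qn (\<iota> k)" by (rule C[OF \<iota>_in_E])
    also have "\<dots> \<le> \<bar>C\<bar> * (sqrt 2 * max 1 (onorm \<iota>) * norm k)"
      by (intro mult_mono qn_\<iota>_le) auto
    finally show "norm (l (\<iota> k)) \<le> norm k * (\<bar>C\<bar> * (sqrt 2 * max 1 (onorm \<iota>)))" by (simp add: mult_ac)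
  qed (simp_all add: lin add scale \<iota>_in_E)
  define h where "h = dual_embed \<iota> l"
  have lh: "l (\<iota> k) = inner h k" for k unfolding h_def by (rule dual_embed_inner[where \<iota>=\<iota> and l=l, OF basis bl])
  define p where "p n = (\<Sum>k\<in>{0<..s n}. inner h (b k) *\<^sub>R b k)" for n
  \<comment> \<open>The coefficients are the values of \<open>l\<close> on the basis, so
    \<open>L n\<close> is l composed with \<open>Q n\<close>, written as an element of E'. Its
    representative \<open>p n\<close> is a partial sum of the expansion of \<open>h\<close>.\<close>
  define L where "L n = (\<Sum>k\<in>{0<..s n}. inner h (b k) *\<^sub>R e k)" for n
  have emb: "dual_embed \<iota> (blinfun_apply (L n)) = p n" for n
    by (rule dual_embed_eqI) (simp add: L_def p_def blinfun.sum_left blinfun.scaleR_left e_\<iota> inner_sum_left)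
  have LQ: "L n z = l (Q n z)" for n z
  proof -
    have "Q n z = \<iota> (\<Sum>k\<in>{0<..s n}. e k z *\<^sub>R b k)"
      by (simp add: Q_eq linear_sum[OF bounded_linear.linear[OF bounded_linear_\<iota>]] lin)
    then show ?thesis by (simp add: lh L_def blinfun.sum_left blinfun.scaleR_left inner_sum_right mult.commute)
  qed
  have p_lim: "p \<longlonglongrightarrow> h"
  proof -
    obtain h' where h': "(\<lambda>n. \<Sum>k=1..n. inner h (b k) *\<^sub>R b k) \<longlonglongrightarrow> h'" "\<And>k. inner h k = inner h' k"
      using orthonormal_expansion[OF basis bounded_linear_inner_right[of h]] by blast
    then have "inner (h' - h) (h' - h) = 0" by (simp add: inner_diff_left)
    then have "h' = h" by simp
    have "{1..m} = {0<..m}" for m :: nat by auto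
    then have "p = (\<lambda>n. \<Sum>k=1..n. inner h (b k) *\<^sub>R b k) \<circ> s" by (auto simp: p_def)
    then show ?thesis using LIMSEQ_subseq_LIMSEQ[OF h'(1) strict_mono_s] \<open>h' = h\<close> by simp
  qed
  have lim: "(\<lambda>n. L n z) \<longlonglongrightarrow> l z" if z: "z \<in> E" for z
  proof -
    have QE: "Q n z \<in> E" for n using Q_in_range[of n z] \<iota>_in_E by auto
    have "norm (l z - L n z) \<le> C * qn (z - Q n z)" for n
    proof -
      have "l z = l (Q n z) + l (z - Q n z)" using add[OF QE E_diff[OF z QE], of n n] by simp
      then show ?thesis using C[OF E_diff[OF z QE], of n] by (simp add: LQ)
    qed
    moreover have "(\<lambda>n. C * qn (z - Q n z)) \<longlonglongrightarrow> 0"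
      using tendsto_mult_right_zero[OF qn_diff_Q_tendsto[OF z]] by simp
    ultimately have "(\<lambda>n. l z - L n z) \<longlonglongrightarrow> 0"
      by (intro Lim_null_comparison[of "\<lambda>n. l z - L n z"]) auto
    then have "(\<lambda>n. l z - (l z - L n z)) \<longlonglongrightarrow> l z - 0" by (intro tendsto_intros)
    then show ?thesis by simp
  qed
  have [measurable]: "blinfun_apply (L n) \<in> borel_measurable ?R" for n
    by (rule measurable_restrict_space1) measurable
  have l_meas [measurable]: "l \<in> borel_measurable ?R"
    by (rule borel_measurable_LIMSEQ_real[of ?R "\<lambda>n. blinfun_apply (L n)"]) (auto simp: space_restrict_space intro: lim)
  have "char (distr ?R borel l) t = char (normal_law 0 (norm h)) t" for t
  proof -
    have charL: "(CLINT z|?R. iexp (t * L n z)) = complex_of_real (exp (- (norm (p n) * t)\<^sup>2 / 2))" for n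
    proof -
      have "(CLINT z|?R. iexp (t * L n z)) = (CLINT z|\<mu>. indicator E z *\<^sub>R iexp (t * L n z))"
        by (rule integral_restrict_space) (simp add: sets_E)
      also have "\<dots> = (CLINT z|\<mu>. iexp (t * L n z))"
        using AE_E by (intro integral_cong_AE) (auto elim!: eventually_mono)
      finally show ?thesis unfolding char_blinfun emb .
    qed
    have "(\<lambda>n. CLINT z|?R. iexp (t * L n z)) \<longlonglongrightarrow> (CLINT z|?R. iexp (t * l z))"
    proof (rule integral_dominated_convergence[where w="\<lambda>_. 1"])
      show "AE z in ?R. (\<lambda>n. iexp (t * L n z)) \<longlonglongrightarrow> iexp (t * l z)"
        by (rule AE_I2) (auto simp: space_restrict_space intro!: tendsto_intros lim)
    qed auto
    moreover have "(\<lambda>n. CLINT z|?R. iexp (t * L n z)) \<longlonglongrightarrow> complex_of_real (exp (- (norm h * t)\<^sup>2 / 2))"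
      unfolding charL by (intro tendsto_intros p_lim) simp
    ultimately have "(CLINT z|?R. iexp (t * l z)) = complex_of_real (exp (- (norm h * t)\<^sup>2 / 2))"
      by (rule LIMSEQ_unique)
    moreover have "char (distr ?R borel l) t = (CLINT z|?R. iexp (t * l z))"
      unfolding char_def by (subst integral_distr) auto
    ultimately show ?thesis by (simp add: char_normal_law)
  qed
  then show ?thesis
    unfolding h_def[symmetric]
    by (intro Levy_uniqueness R.real_distribution_distr real_distribution_normal_law) auto
qed

lemma abstract_wiener_space_E: "abstract_wiener_space E qn \<iota> (restrict_space \<mu> E)"
  unfolding abstract_wiener_space_def
proof (intro conjI ballI banach_on_E separable_H inj_\<iota> range_\<iota>_dense_E sets_restrict_E
    prob_space_restrict_E distr_restrict_E)
  show "linear \<iota>" by (rule bounded_linear.linear[OF bounded_linear_\<iota>])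
  show "range \<iota> \<subseteq> E" using \<iota>_in_E by auto
  show "\<exists>C. \<forall>h. qn (\<iota> h) \<le> C * norm h" using qn_\<iota>_le by blast
  show "space (restrict_space \<mu> E) = E" by (simp add: space_restrict_space)
qed

section \<open>Rotation invariance and square integrability\<close>

sublocale \<mu>\<mu>: pair_prob_space \<mu> \<mu> ..

text \<open>Independence leaves only the sum of the two squared norms, and this is the quantity that
  the rotation preserves.\<close>

lemma char_pair:
  fixes L L' :: "'e \<Rightarrow>\<^sub>L real"
  shows "(CLINT \<omega>|\<mu> \<Otimes>\<^sub>M \<mu>. iexp (L (fst \<omega>) + L' (snd \<omega>))) =
    complex_of_real (exp (- ((norm (dual_embed \<iota> L))\<^sup>2 + (norm (dual_embed \<iota> L'))\<^sup>2) / 2))"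
proof -
  have "(CLINT \<omega>|\<mu> \<Otimes>\<^sub>M \<mu>. iexp (L (fst \<omega>) + L' (snd \<omega>))) =
      (CLINT x|\<mu>. CLINT y|\<mu>. iexp (L x + L' y))"
    by (subst \<mu>\<mu>.integral_fst'[symmetric])
      (auto intro!: \<mu>\<mu>.P.integrable_const_bound[where B=1])
  also have "\<dots> = (CLINT x|\<mu>. CLINT y|\<mu>. iexp (L x) * iexp (L' y))"
    by (simp add: exp_add distrib_left)
  also have "\<dots> = (CLINT x|\<mu>. iexp (1 * L x)) * (CLINT y|\<mu>. iexp (1 * L' y))"
    by simp
  also have "\<dots> = complex_of_real (exp (- (norm (dual_embed \<iota> L))\<^sup>2 / 2) * exp (- (norm (dual_embed \<iota> L'))\<^sup>2 / 2))"
    unfolding char_blinfun by simp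
  finally show ?thesis by (simp add: add_divide_distrib diff_divide_distrib flip: exp_add)
qed

lemma dual_embed_add:
  fixes L L' :: "'e \<Rightarrow>\<^sub>L real"
  shows "dual_embed \<iota> (blinfun_apply (a *\<^sub>R L + c *\<^sub>R L')) = a *\<^sub>R dual_embed \<iota> L + c *\<^sub>R dual_embed \<iota> L'"
  by (rule dual_embed_eqI) (simp add: blinfun.add_left blinfun.scaleR_left inner_simps flip: blinfun_\<iota>)

text \<open>The rotated pair is only tested against the coordinates \<^term>\<open>e n\<close>: without a second countability
  instance for \<^typ>\<open>'e\<close>, addition is not known to be measurable for the product sigma-algebra.\<close>

lemma rotation_invariance:
  defines "S \<equiv> Pi\<^sub>M (UNIV :: (bool \<times> nat) set) (\<lambda>_. borel :: real measure)"
  shows "distr (\<mu> \<Otimes>\<^sub>M \<mu>) S (\<lambda>\<omega> (i, n). if i then e n (fst \<omega>) else e n (snd \<omega>)) =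
    distr (\<mu> \<Otimes>\<^sub>M \<mu>) S (\<lambda>\<omega> (i, n). if i then e n ((fst \<omega> + snd \<omega>) /\<^sub>R sqrt 2) else e n ((fst \<omega> - snd \<omega>) /\<^sub>R sqrt 2))"
proof -
  define X where "X v \<omega> = fst v (fst \<omega>) + snd v (snd \<omega>)" for v :: "('e \<Rightarrow>\<^sub>L real) \<times> ('e \<Rightarrow>\<^sub>L real)" and \<omega>
  \<comment> \<open>The transposed rotation: \<open>X (\<rho> v)\<close> at (x, y) is
    \<open>X v\<close> at the rotated pair.\<close>
  define \<rho> where "\<rho> v = ((1 / sqrt 2) *\<^sub>R fst v + (1 / sqrt 2) *\<^sub>R snd v, (1 / sqrt 2) *\<^sub>R fst v + (- 1 / sqrt 2) *\<^sub>R snd v)"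
    for v :: "('e \<Rightarrow>\<^sub>L real) \<times> ('e \<Rightarrow>\<^sub>L real)"
  define u where "u = (\<lambda>(i, n). if i then (e n, 0) else (0, e n))"
  have [measurable]: "X v \<in> borel_measurable (\<mu> \<Otimes>\<^sub>M \<mu>)" for v
    unfolding X_def[abs_def] by measurable
  have linX: "linear (\<lambda>v. X v \<omega>)" for \<omega>
    by (rule linearI) (simp_all add: X_def blinfun.add_left blinfun.scaleR_left algebra_simps)
  have lin\<rho>: "linear \<rho>"
    by (rule linearI) (simp_all add: \<rho>_def scaleR_add_right algebra_simps)
  have char: "(CLINT \<omega>|\<mu> \<Otimes>\<^sub>M \<mu>. iexp (X v \<omega>)) = (CLINT \<omega>|\<mu> \<Otimes>\<^sub>M \<mu>. iexp (X (\<rho> v) \<omega>))" for v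
  proof -
    \<comment> \<open>The parallelogram identity, normalised by 1 / sqrt 2.\<close>
    have "(norm ((1 / sqrt 2) *\<^sub>R h + (1 / sqrt 2) *\<^sub>R k))\<^sup>2 + (norm ((1 / sqrt 2) *\<^sub>R h + (- 1 / sqrt 2) *\<^sub>R k))\<^sup>2
        = (norm h)\<^sup>2 + (norm k)\<^sup>2" for h k :: 'h
      by (simp add: power2_norm_eq_inner inner_add_left inner_add_right inner_diff_left inner_diff_right inner_commute field_simps)
    then show ?thesis unfolding X_def \<rho>_def fst_conv snd_conv char_pair dual_embed_add by simp
  qed
  have "distr (\<mu> \<Otimes>\<^sub>M \<mu>) S (\<lambda>\<omega> i. X (u i) \<omega>) = distr (\<mu> \<Otimes>\<^sub>M \<mu>) S (\<lambda>\<omega> i. X (\<rho> (u i)) \<omega>)"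
    unfolding S_def
    using \<mu>\<mu>.P.prob_space_axioms linX linear_compose[OF lin\<rho> linX] char
    by (intro cramer_wold[where Y="\<lambda>v. X (\<rho> v)"]) (auto simp: o_def)
  moreover have "(\<lambda>\<omega> i. X (u i) \<omega>) = (\<lambda>\<omega> (i, n). if i then e n (fst \<omega>) else e n (snd \<omega>))"
    by (auto simp: fun_eq_iff X_def u_def)
  moreover have "(\<lambda>\<omega> i. X (\<rho> (u i)) \<omega>) =
      (\<lambda>\<omega> (i, n). if i then e n ((fst \<omega> + snd \<omega>) /\<^sub>R sqrt 2) else e n ((fst \<omega> - snd \<omega>) /\<^sub>R sqrt 2))"
    by (auto simp: fun_eq_iff X_def u_def \<rho>_def blinfun.add_left blinfun.scaleR_left blinfun.add_right
        blinfun.diff_right blinfun.scaleR_right blinfun.minus_left field_simps)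
  ultimately show ?thesis by simp
qed

text \<open>\<open>part\<close> as a function of the coordinate sequence alone, so that events about
  \<open>q\<close> can be transported by the law of the coordinates.\<close>

definition coord_part :: "nat \<Rightarrow> (nat \<Rightarrow> real) \<Rightarrow> real" where
  "coord_part N c = sqrt ((\<Sum>n<N. 2 ^ n * (norm (\<Sum>k\<in>{s n<..s (Suc n)}. c k *\<^sub>R \<iota> (b k)))\<^sup>2) + (\<Sum>n<N. w n * \<bar>c (Suc n)\<bar>)\<^sup>2)"

lemma q_coord: "q z = (SUP N. ennreal (coord_part N (\<lambda>n. e n z)))"
  unfolding q_eq_SUP part_def coord_part_def D_eq ..

text \<open>The map is continuous for the product topology, whose Borel sets are the product
  sigma-algebra because the index set is countable.\<close>

lemma measurable_coord_part [measurable]: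
  "(\<lambda>c. coord_part N (\<lambda>n. c (i, n))) \<in> borel_measurable (Pi\<^sub>M (UNIV :: (bool \<times> nat) set) (\<lambda>_. borel))"
proof -
  have "(\<lambda>c :: bool \<times> nat \<Rightarrow> real. coord_part N (\<lambda>n. c (i, n))) \<in> borel_measurable borel"
    unfolding coord_part_def
    by (intro borel_measurable_continuous_onI continuous_intros continuous_on_product_coordinates)
  then show ?thesis
    using measurable_cong_sets[OF sets_PiM_equal_borel refl] by blast
qed

lemma prob_pair:
  "measure (\<mu> \<Otimes>\<^sub>M \<mu>) {\<omega> \<in> space (\<mu> \<Otimes>\<^sub>M \<mu>). P (fst \<omega>) \<and> R (snd \<omega>)} = \<mu>.prob {z \<in> space \<mu>. P z} * \<mu>.prob {z \<in> space \<mu>. R z}"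
  if "{z \<in> space \<mu>. P z} \<in> sets \<mu>" "{z \<in> space \<mu>. R z} \<in> sets \<mu>"
proof -
  have "{\<omega> \<in> space (\<mu> \<Otimes>\<^sub>M \<mu>). P (fst \<omega>) \<and> R (snd \<omega>)} = {z \<in> space \<mu>. P z} \<times> {z \<in> space \<mu>. R z}"
    by (auto simp: space_pair_measure)
  then show ?thesis using that \<mu>.emeasure_pair_measure_Times[OF that]
    by (simp add: measure_def enn2real_mult)
qed

text \<open>Let u and v be the normalised sum and difference of x and y. Then v = u - sqrt 2 y =
  sqrt 2 x - u, so q u \<le> \<open>\<sigma>\<close> and q v > t force both q x and q y above (t -
  \<open>\<sigma>\<close>) / sqrt 2. Independence makes both sides products, and rotation invariance
  identifies the law of (u, v) on coordinates.\<close>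

lemma fernique_inequality:
  assumes "0 \<le> \<sigma>" "\<sigma> \<le> t"
  shows "\<mu>.prob {z \<in> space \<mu>. q z \<le> ennreal \<sigma>} * \<mu>.prob {z \<in> space \<mu>. q z > ennreal t}
    \<le> (\<mu>.prob {z \<in> space \<mu>. q z > ennreal ((t - \<sigma>) / sqrt 2)})\<^sup>2"
proof -
  define \<tau> where "\<tau> = (t - \<sigma>) / sqrt 2"
  let ?S = "Pi\<^sub>M (UNIV :: (bool \<times> nat) set) (\<lambda>_. borel :: real measure)"
  let ?X = "\<lambda>\<omega> (i :: bool, n). if i then e n (fst \<omega>) else e n (snd \<omega>)"
  let ?Y = "\<lambda>\<omega> (i :: bool, n). if i then e n ((fst \<omega> + snd \<omega>) /\<^sub>R sqrt 2) else e n ((fst \<omega> - snd \<omega>) /\<^sub>R sqrt 2)"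
  define A where "A = {c \<in> space ?S. (SUP N. ennreal (coord_part N (\<lambda>n. c (True, n)))) \<le> ennreal \<sigma> \<and>
    (SUP N. ennreal (coord_part N (\<lambda>n. c (False, n)))) > ennreal t}"
  have A: "A \<in> sets ?S" unfolding A_def by measurable
  have [measurable]: "?X \<in> measurable (\<mu> \<Otimes>\<^sub>M \<mu>) ?S"
    by (rule measurable_PiM_single') (auto simp: split_beta)
  have [measurable]: "?Y \<in> measurable (\<mu> \<Otimes>\<^sub>M \<mu>) ?S"
  proof (rule measurable_PiM_single')
    fix i :: "bool \<times> nat"
    show "(\<lambda>\<omega>. ?Y \<omega> i) \<in> borel_measurable (\<mu> \<Otimes>\<^sub>M \<mu>)"
      by (cases i; cases "fst i") (auto simp: blinfun.add_right blinfun.diff_right blinfun.scaleR_right)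
  qed auto
  have "\<mu>.prob {z \<in> space \<mu>. q z \<le> ennreal \<sigma>} * \<mu>.prob {z \<in> space \<mu>. q z > ennreal t}
      = measure (\<mu> \<Otimes>\<^sub>M \<mu>) {\<omega> \<in> space (\<mu> \<Otimes>\<^sub>M \<mu>). q (fst \<omega>) \<le> ennreal \<sigma> \<and> q (snd \<omega>) > ennreal t}"
    by (rule prob_pair[symmetric]) measurable
  also have "\<dots> = measure (distr (\<mu> \<Otimes>\<^sub>M \<mu>) ?S ?X) A"
    using A by (subst measure_distr) (auto simp: A_def q_coord space_PiM intro!: arg_cong[where f="measure _"])
  also have "\<dots> = measure (distr (\<mu> \<Otimes>\<^sub>M \<mu>) ?S ?Y) A"
    by (simp only: rotation_invariance)
  also have "\<dots> = measure (\<mu> \<Otimes>\<^sub>M \<mu>) (?Y -` A \<inter> space (\<mu> \<Otimes>\<^sub>M \<mu>))"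
    using A by (subst measure_distr) auto
  also have "\<dots> \<le> measure (\<mu> \<Otimes>\<^sub>M \<mu>) {\<omega> \<in> space (\<mu> \<Otimes>\<^sub>M \<mu>). q (fst \<omega>) > ennreal \<tau> \<and> q (snd \<omega>) > ennreal \<tau>}"
  proof (rule \<mu>\<mu>.P.finite_measure_mono)
    have \<tau>: "0 \<le> \<tau>" "\<sigma> + sqrt 2 * \<tau> = t" using assms by (auto simp: \<tau>_def)
    \<comment> \<open>The contrapositive, valid for either representation of \<open>v\<close>
      because \<open>part\<close> is even; \<open>\<tau>\<close> solves \<open>\<sigma>\<close> +
      sqrt 2 \<open>\<tau>\<close> = t.\<close>
    have *: "q v \<le> ennreal t" if "q y \<le> ennreal \<tau>" "q u \<le> ennreal \<sigma>" "v = u - sqrt 2 *\<^sub>R y \<or> v = sqrt 2 *\<^sub>R y - u" for u v y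
    proof -
      have "part N v \<le> t" for N
      proof -
        have "part N y \<le> \<tau>" "part N u \<le> \<sigma>" using that \<tau>(1) assms(1) by (auto simp: q_le_iff)
        moreover have "part N v \<le> part N u + sqrt 2 * part N y"
          using that(3) part_add[of N u "- (sqrt 2 *\<^sub>R y)"] part_add[of N "- u" "sqrt 2 *\<^sub>R y"]
          by (auto simp: part_uminus part_scaleR)
        moreover have "sqrt 2 * part N y \<le> sqrt 2 * \<tau>" using calculation(1) by (intro mult_left_mono) auto
        ultimately show ?thesis using \<tau>(2) by linarith
      qed
      then show ?thesis using assms by (simp add: q_le_iff)
    qed
    show "?Y -` A \<inter> space (\<mu> \<Otimes>\<^sub>M \<mu>) \<subseteq> {\<omega> \<in> space (\<mu> \<Otimes>\<^sub>M \<mu>). q (fst \<omega>) > ennreal \<tau> \<and> q (snd \<omega>) > ennreal \<tau>}"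
    proof safe
      fix x y assume A: "?Y (x, y) \<in> A"
      define u where "u = (x + y) /\<^sub>R sqrt 2"
      define v where "v = (x - y) /\<^sub>R sqrt 2"
      have uv: "q u \<le> ennreal \<sigma>" "\<not> q v \<le> ennreal t"
        using A by (auto simp: A_def q_coord u_def v_def)
      have sq: "inverse (sqrt 2) + inverse (sqrt 2) = sqrt (2::real)"
        by (simp add: field_simps)
      have "sqrt 2 *\<^sub>R x = inverse (sqrt 2) *\<^sub>R x + inverse (sqrt 2) *\<^sub>R x" "sqrt 2 *\<^sub>R y = inverse (sqrt 2) *\<^sub>R y + inverse (sqrt 2) *\<^sub>R y"
        by (simp_all only: sq flip: scaleR_add_left)
      then have "v = u - sqrt 2 *\<^sub>R y" "v = sqrt 2 *\<^sub>R x - u"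
        by (simp_all add: u_def v_def scaleR_add_right scaleR_diff_right)
      then show "q (fst (x, y)) > ennreal \<tau>" "q (snd (x, y)) > ennreal \<tau>"
        using *[of x u v] *[of y u v] uv by (auto simp: not_le[symmetric])
    qed
  qed measurable
  also have "\<dots> = (\<mu>.prob {z \<in> space \<mu>. q z > ennreal \<tau>})\<^sup>2"
    unfolding power2_eq_square by (rule prob_pair) measurable
  finally show ?thesis by (simp add: \<tau>_def)
qed

lemma q_square_integrable: "(\<integral>\<^sup>+z. (q z)\<^sup>2 \<partial>\<mu>) < \<infinity>"
proof (rule fernique_second_moment[OF prob_space_\<mu> measurable_q])
  show "AE z in \<mu>. q z < \<infinity>" using AE_E by (simp add: E_sub_def)
qed (rule fernique_inequality)

end

text \<open>The bound in (ii) has two forms. With the constant sqrt 3 alone it presupposes the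
  normalisation that the embedding of H into E is a contraction; for a general embedding the factor
  \<open>max 1 (onorm \<iota>)\<close> accounts for the first block. Compactness of the embedding is
  expressed by q-bounded sets having compact closure in E.\<close>

theorem proposition2p4:
  fixes \<iota> :: "'h::{real_inner,complete_space} \<Rightarrow> 'e::banach"
    and \<mu> :: "'e measure" and x :: 'e
    and e :: "nat \<Rightarrow> 'e \<Rightarrow>\<^sub>L real" and r :: "nat \<Rightarrow> nat"
  assumes aws: "abstract_wiener_space UNIV norm \<iota> \<mu>"
    and x: "x \<notin> range \<iota>"
    and basis: "orthonormal_basis (\<lambda>n. dual_embed \<iota> (e n))"
    and separates: "\<forall>y z. (\<forall>n\<ge>1. e n y = e n z) \<longrightarrow> y = z"
    and growth: "\<forall>n\<ge>1. e n x \<ge> 2 powr (real n / 2)"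
    and subseq: "strict_mono r"
    and Q_close: "\<forall>n\<ge>1. onorm (\<lambda>h. \<iota> h - Q_tilde \<iota> e r n (\<iota> h)) \<le> (1/2) ^ n"
    and Q_prob: "\<forall>n\<ge>1. measure \<mu> {z. norm (z - Q_tilde \<iota> e r n z) > (1/2) ^ n} \<le> (1/2) ^ n"
  shows "(emeasure \<mu> (E_sub \<iota> e r) = 1) \<and>
    ((\<forall>h. norm (\<iota> h) \<le> norm h) \<longrightarrow> (\<forall>h. q_fun \<iota> e r (\<iota> h) \<le> ennreal (sqrt 3 * norm h))) \<and>
    (range \<iota> \<subseteq> E_sub \<iota> e r \<and>
      (\<forall>h. q_fun \<iota> e r (\<iota> h) \<le> ennreal (sqrt 3 * max 1 (onorm \<iota>) * norm h))) \<and>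
    (\<forall>z. ennreal (norm z) \<le> ennreal (sqrt 2) * q_fun \<iota> e r z) \<and>
    (banach_on (E_sub \<iota> e r) (q_norm \<iota> e r)) \<and>
    (\<forall>B \<subseteq> E_sub \<iota> e r. (\<exists>C. \<forall>z\<in>B. q_norm \<iota> e r z \<le> C) \<longrightarrow> compact (closure B)) \<and>
    (abstract_wiener_space (E_sub \<iota> e r) (q_norm \<iota> e r) \<iota> (restrict_space \<mu> (E_sub \<iota> e r))) \<and>
    (q_fun \<iota> e r \<in> borel_measurable \<mu> \<and> (\<integral>\<^sup>+ z. (q_fun \<iota> e r z)\<^sup>2 \<partial>\<mu>) < \<infinity>)"
proof -
  interpret wiener_basis \<iota> \<mu> e r
    using aws basis separates subseq Q_close Q_prob by unfold_locales
  show ?thesis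
    using emeasure_E q_\<iota>_le_contraction \<iota>_in_E q_\<iota>_le norm_le_q banach_on_E compact_closure_bounded
      abstract_wiener_space_E measurable_q q_square_integrable
    by blast
qed

end
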